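(* Let $q$ be a prime power. Then each of the following holds whenever the second argument of $P$ on its left-hand side is positive: $$P(q,q-4)\ge (q+1)q(q-1)\quad (q>4),$$ $$P(q,q-3)\ge 2q(q-1)\quad (q>3),$$ $$P(q-1,q-4)\ge (q+1)(q-1)\quad (q>4),$$ $$P(q-1,q-6)\ge 2(q+1)(q-1)\quad (q>6).$$ Additionally, $P(11,5)\ge 95040$ and $P(11,6)\ge 15840$.
   Context: $S_n$ is the group of permutations of $Z_n=\{0,1,\ldots,n-1\}$. The Hamming distance $d(\mathbf{x},\mathbf{y})$ of $\mathbf{x},\mathbf{y}\in S_n$ is the number of $i\in Z_n$ with $\mathbf{x}(i)\neq\mathbf{y}(i)$. For positive integers $d\le n$, an $(n,d)$ permutation array (PA) is a subset $C\subseteq S_n$ in which any two distinct elements have distance at least $d$; $P(n,d)$ is the maximum size of an $(n,d)$ PA. *)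

theory Defs
  imports "HOL-Number_Theory.Prime_Powers" "HOL-Combinatorics.Permutations"
begin

definition Sym :: "nat \<Rightarrow> (nat \<Rightarrow> nat) set" where
  "Sym n = {x. x permutes {..<n}}"

definition hamming_dist :: "nat \<Rightarrow> (nat \<Rightarrow> nat) \<Rightarrow> (nat \<Rightarrow> nat) \<Rightarrow> nat" where
  "hamming_dist n x y = card {i \<in> {..<n}. x i \<noteq> y i}"

definition permutation_array :: "nat \<Rightarrow> nat \<Rightarrow> (nat \<Rightarrow> nat) set \<Rightarrow> bool" where
  "permutation_array n d C \<longleftrightarrow>
     C \<subseteq> Sym n \<and> (\<forall>x\<in>C. \<forall>y\<in>C. x \<noteq> y \<longrightarrow> d \<le> hamming_dist n x y)"

text \<open>Intended for \<open>0 < d \<le> n\<close>. The set of sizes is finite, as \<open>Sym n\<close> is, and nonempty, as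
  the empty set is an array, so \<open>Max\<close> is well-defined.\<close>

definition P :: "nat \<Rightarrow> nat \<Rightarrow> nat" where
  "P n d = Max {card C | C. permutation_array n d C}"

end

theory Submission
  imports Defs "HOL-Algebra.Algebraic_Closure" "HOL-Number_Theory.Residues"
begin

text \<open>If \<open>F\<close> is a set of points and \<open>x\<close> a permutation, redirect the points outside \<open>F\<close> that \<open>x\<close>
  sends into \<open>F\<close>, so that a permutation of the complement of \<open>F\<close> results. For two permutations
  this lowers the distance by at most the number of points of \<open>F\<close> on which they differ plus the number
  of redirected points. For \<open>F = {\<infinity>}\<close> the loss is at most 3, and at most 2 if only permutations sending
  \<open>\<infinity>\<close> to one of \<open>\<infinity>, 0\<close> are used; for \<open>F = {\<infinity>, 0}\<close> it is at most 3 among the permutations fixing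
  \<open>\<infinity>\<close> or swapping \<open>\<infinity>\<close> with \<open>0\<close>, and at most 4 among those sending a point of \<open>F\<close> into \<open>F\<close>.

  This is applied to the sharply 3-transitive group PGL(2,q) on \<open>q + 1\<close> points, whose nonidentity
  elements fix at most 2 points, and to the sharply 5-transitive Mathieu group on 12 points, whose
  nonidentity elements fix at most 4. Both arise by one-point extension: if \<open>h\<close> is an involution swapping
  a new point \<open>z\<close> with \<open>w\<close>, normalising the stabiliser of \<open>w\<close> in a 2-transitive group \<open>G\<close>, and if
  \<open>h g0 h\<close> lies in \<open>G h G\<close> for some \<open>g0\<close> moving \<open>w\<close>, then the union of \<open>G\<close> and \<open>G h G\<close> is a group in which
  the stabiliser of \<open>z\<close> is \<open>G\<close>.\<close>

section \<open>Contraction of permutation arrays\<close>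

lemma card_le_P:
  assumes "permutation_array n d C"
  shows "card C \<le> P n d"
proof -
  have fin: "finite (Sym n)"
    unfolding Sym_def by (rule finite_permutations) simp
  have "{card C | C. permutation_array n d C} \<subseteq> card ` Pow (Sym n)"
    unfolding permutation_array_def by auto
  then have "finite {card C | C. permutation_array n d C}"
    using fin finite_subset by blast
  then show ?thesis
    unfolding P_def using assms by (intro Max_ge) auto
qed

text \<open>Conjugation by a bijection onto \<open>{..<card A}\<close> preserves distances, so
  arrays on any finite point set, such as a projective line, bound \<open>P\<close> from
  below.\<close>

lemma card_le_P_relabel:
  fixes A :: "'a set"
  assumes fin: "finite A"
    and C: "\<And>x. x \<in> C \<Longrightarrow> x permutes A"
    and dist: "\<And>x y. x \<in> C \<Longrightarrow> y \<in> C \<Longrightarrow> x \<noteq> y \<Longrightarrow> d \<le> card {s \<in> A. x s \<noteq> y s}"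
  shows "card C \<le> P (card A) d"
proof -
  let ?n = "card A"
  obtain f where f: "bij_betw f A {..<?n}"
    using finite_same_card_bij[OF fin finite_lessThan] by auto
  define conj where "conj x = (\<lambda>i. if i \<in> {..<?n} then f (x (inv_into A f i)) else i)" for x
  have conj_f: "conj x (f s) = f (x s)" if "s \<in> A" for x s
    using that f bij_betwE[OF f] by (simp add: conj_def bij_betw_inv_into_left)
  have perm: "conj x permutes {..<?n}" if "x \<in> C" for x
    unfolding conj_def by (rule permutes_bij_inv_into[OF C[OF that] f])
  have inj_f: "f s = f t \<longleftrightarrow> s = t" if "s \<in> A" "t \<in> A" for s t
    using f that by (metis bij_betw_inv_into_left)
  have neq: "{i \<in> {..<?n}. conj x i \<noteq> conj y i} = f ` {s \<in> A. x s \<noteq> y s}"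
    if "x \<in> C" "y \<in> C" for x y
  proof -
    have "x s \<in> A" "y s \<in> A" if "s \<in> A" for s
      using C \<open>x \<in> C\<close> \<open>y \<in> C\<close> that by (auto simp: permutes_in_image)
    moreover have "{..<?n} = f ` A"
      using f by (simp add: bij_betw_def)
    ultimately show ?thesis
      using conj_f inj_f by (auto simp: image_iff)
  qed
  have hd: "hamming_dist ?n (conj x) (conj y) = card {s \<in> A. x s \<noteq> y s}"
    if "x \<in> C" "y \<in> C" for x y
    unfolding hamming_dist_def neq[OF that]
    by (rule card_image) (use inj_f in \<open>auto simp: inj_on_def\<close>)
  have inj: "inj_on conj C"
  proof (rule inj_onI)
    fix x y assume xy: "x \<in> C" "y \<in> C" "conj x = conj y"
    then have "{s \<in> A. x s \<noteq> y s} = {}"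
      using neq[of x y] by simp
    then have "x s = y s" for s
      using xy(1,2)[THEN C] by (cases "s \<in> A") (auto simp: permutes_not_in)
    then show "x = y" by blast
  qed
  have "permutation_array ?n d (conj ` C)"
    unfolding permutation_array_def Sym_def using perm dist hd by auto
  from card_le_P[OF this] show ?thesis
    by (simp add: card_image[OF inj])
qed

text \<open>By counting, the set \<open>D\<close> of points outside \<open>F\<close> that
  \<open>x\<close> sends into \<open>F\<close> has as many elements as the part of
  \<open>A - F\<close> missed by the image of the remaining points \<open>K\<close>; any bijection
  between the two redirects \<open>D\<close>.\<close>

lemma exists_contraction:
  assumes fin: "finite A" and x: "x permutes A" and "F \<subseteq> A"
  shows "\<exists>x'. x' permutes (A - F) \<and> (\<forall>s\<in>A - F. x s \<notin> F \<longrightarrow> x' s = x s)"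
proof -
  define D where "D = {s \<in> A - F. x s \<in> F}"
  define K where "K = {s \<in> A - F. x s \<notin> F}"
  have K: "bij_betw x K (x ` K)"
    using x by (auto simp: bij_betw_def intro: inj_on_subset[OF permutes_inj_on])
  have img: "x ` K \<subseteq> A - F"
    using x by (auto simp: K_def permutes_in_image)
  have DK: "D \<union> K = A - F" "D \<inter> K = {}"
    by (auto simp: D_def K_def)
  have "card D = card (A - F) - card K"
    using DK fin by (metis card_Un_disjoint diff_add_inverse2 finite_Diff finite_Un)
  also have "card K = card (x ` K)"
    using bij_betw_same_card[OF K] .
  also have "card (A - F) - card (x ` K) = card (A - F - x ` K)"
    using img fin by (metis card_Diff_subset finite_Diff finite_subset)
  finally obtain g where g: "bij_betw g D (A - F - x ` K)"
    using fin finite_same_card_bij[of D "A - F - x ` K"] by (auto simp: D_def)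
  define x' where "x' s = (if s \<in> K then x s else if s \<in> D then g s else s)" for s
  have "bij_betw x' K (x ` K)"
    using K by (subst bij_betw_cong[of _ _ x]) (auto simp: x'_def)
  moreover have "bij_betw x' D (A - F - x ` K)"
    using g DK by (subst bij_betw_cong[of _ _ g]) (auto simp: x'_def)
  ultimately have "bij_betw x' (K \<union> D) (x ` K \<union> (A - F - x ` K))"
    by (rule bij_betw_combine) auto
  moreover have "K \<union> D = A - F" "x ` K \<union> (A - F - x ` K) = A - F"
    using DK img by auto
  ultimately have "x' permutes (A - F)"
    using DK by (intro bij_imp_permutes) (auto simp: x'_def)
  then show ?thesis
    by (intro exI[of _ x']) (auto simp: x'_def K_def)
qed

text \<open>A position where \<open>x\<close> and \<open>y\<close> differ lies in \<open>F\<close>,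
  or is redirected for one of them, or is one where the contractions still differ. As
  \<open>0 < d\<close>, distinct permutations have distinct contractions, so the array keeps its
  size.\<close>

lemma card_le_P_contraction:
  assumes fin: "finite A" and F: "F \<subseteq> A" and d: "0 < d"
    and C: "\<And>x. x \<in> C \<Longrightarrow> x permutes A"
    and dist: "\<And>x y. x \<in> C \<Longrightarrow> y \<in> C \<Longrightarrow> x \<noteq> y \<Longrightarrow>
      d + card {s \<in> F. x s \<noteq> y s} + card {s \<in> A - F. x s \<in> F \<or> y s \<in> F}
        \<le> card {s \<in> A. x s \<noteq> y s}"
  shows "card C \<le> P (card (A - F)) d"
proof -
  obtain c where c: "\<And>x. x \<in> C \<Longrightarrow> c x permutes (A - F)"
    and c_eq: "\<And>x s. x \<in> C \<Longrightarrow> s \<in> A - F \<Longrightarrow> x s \<notin> F \<Longrightarrow> c x s = x s"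
    using exists_contraction[OF fin C F] by metis
  have dist_c: "d \<le> card {s \<in> A - F. c x s \<noteq> c y s}" if xy: "x \<in> C" "y \<in> C" "x \<noteq> y" for x y
  proof -
    let ?U = "{s \<in> F. x s \<noteq> y s}" and ?V = "{s \<in> A - F. x s \<in> F \<or> y s \<in> F}"
    let ?W = "{s \<in> A - F. c x s \<noteq> c y s}"
    have "{s \<in> A. x s \<noteq> y s} \<subseteq> ?W \<union> ?U \<union> ?V"
      using c_eq xy F by auto
    then have "card {s \<in> A. x s \<noteq> y s} \<le> card (?W \<union> ?U \<union> ?V)"
      using fin F by (intro card_mono) (auto intro: finite_subset)
    also have "\<dots> \<le> card ?W + card ?U + card ?V"
      by (meson add_le_mono1 card_Un_le le_trans)
    finally show ?thesis
      using dist[OF xy] by linarith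
  qed
  have inj: "inj_on c C"
    using dist_c d by (fastforce intro: inj_onI)
  have "card (c ` C) \<le> P (card (A - F)) d"
    using fin c dist_c by (intro card_le_P_relabel) auto
  then show ?thesis
    by (simp add: card_image[OF inj])
qed


section \<open>Permutation groups\<close>

text \<open>Closure under inverses is automatic, since \<open>A\<close> is finite.\<close>

definition perm_group :: "'a set \<Rightarrow> ('a \<Rightarrow> 'a) set \<Rightarrow> bool" where
  "perm_group A G \<longleftrightarrow> finite A \<and> (\<forall>x\<in>G. x permutes A) \<and> id \<in> G \<and> (\<forall>x\<in>G. \<forall>y\<in>G. x \<circ> y \<in> G)"

definition transitive_on :: "'a set \<Rightarrow> ('a \<Rightarrow> 'a) set \<Rightarrow> bool" where
  "transitive_on A G \<longleftrightarrow> (\<forall>s\<in>A. \<forall>t\<in>A. \<exists>g\<in>G. g s = t)"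

definition fixes_at_most :: "nat \<Rightarrow> 'a set \<Rightarrow> ('a \<Rightarrow> 'a) set \<Rightarrow> bool" where
  "fixes_at_most m A G \<longleftrightarrow> (\<forall>g\<in>G. g \<noteq> id \<longrightarrow> card {s \<in> A. g s = s} \<le> m)"

lemma perm_groupD:
  assumes "perm_group A G"
  shows "finite A" "\<And>x. x \<in> G \<Longrightarrow> x permutes A" "id \<in> G"
    "\<And>x y. x \<in> G \<Longrightarrow> y \<in> G \<Longrightarrow> x \<circ> y \<in> G" "finite G"
proof -
  show "finite A" "\<And>x. x \<in> G \<Longrightarrow> x permutes A" "id \<in> G" "\<And>x y. x \<in> G \<Longrightarrow> y \<in> G \<Longrightarrow> x \<circ> y \<in> G"
    using assms by (auto simp: perm_group_def)
  then show "finite G"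
    by (metis finite_permutations finite_subset mem_Collect_eq subsetI)
qed

lemma inj_comp_left: "inj x \<Longrightarrow> inj_on ((\<circ>) x) G"
  by (auto simp: inj_on_def fun_eq_iff)

text \<open>Left multiplication by \<open>x\<close> is an injective self-map of the finite set
  \<open>G\<close>, hence surjective, and so reaches \<open>id\<close>.\<close>

lemma perm_group_inverse:
  assumes G: "perm_group A G" and x: "x \<in> G"
  obtains y where "y \<in> G" "x \<circ> y = id" "y \<circ> x = id"
proof -
  note G' = perm_groupD[OF G]
  have inj: "inj x"
    using G'(2)[OF x] by (rule permutes_inj)
  have "(\<circ>) x ` G = G"
    by (rule endo_inj_surj) (use G' x inj inj_comp_left in auto)
  then obtain y where y: "y \<in> G" "x \<circ> y = id"
    using G'(3) by (metis imageE)
  have "y \<circ> x = id"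
  proof
    fix s
    have "x (y (x s)) = x s"
      using y(2) by (metis comp_apply id_apply)
    then show "(y \<circ> x) s = id s"
      using inj by (simp add: inj_def)
  qed
  with y show thesis
    by (rule that)
qed

lemma transitive_onI:
  assumes G: "perm_group A G" and t: "\<And>s. s \<in> A \<Longrightarrow> \<exists>g\<in>G. g w = s"
  shows "transitive_on A G"
  unfolding transitive_on_def
proof (intro ballI)
  fix s u assume su: "s \<in> A" "u \<in> A"
  obtain g g' where g: "g \<in> G" "g w = s" "g' \<in> G" "g' w = u"
    using t su by blast
  obtain k where k: "k \<in> G" "k \<circ> g = id"
    using perm_group_inverse[OF G g(1)] by metis
  have "(g' \<circ> k) s = u"
    using g k by (metis comp_apply id_apply)
  then show "\<exists>g\<in>G. g s = u"
    using perm_groupD(4)[OF G g(3) k(1)] by blast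
qed

text \<open>Orbit-stabiliser: with \<open>c s\<close> a chosen element sending \<open>w\<close> to
  \<open>s\<close>, every element of \<open>G\<close> is uniquely \<open>c s \<circ> g\<close> with
  \<open>g\<close> fixing \<open>w\<close>.\<close>

lemma card_transitive:
  assumes G: "perm_group A G" and t: "transitive_on A G" and w: "w \<in> A"
  shows "card G = card A * card {g \<in> G. g w = w}"
proof -
  let ?H = "{g \<in> G. g w = w}"
  obtain c where c: "\<And>s. s \<in> A \<Longrightarrow> c s \<in> G \<and> c s w = s"
    using t w unfolding transitive_on_def by metis
  have "bij_betw (\<lambda>(s, g). c s \<circ> g) (A \<times> ?H) G"
    unfolding bij_betw_def
  proof
    show "inj_on (\<lambda>(s, g). c s \<circ> g) (A \<times> ?H)"
    proof (rule inj_onI, clarsimp)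
      fix s g s' g'
      assume *: "s \<in> A" "s' \<in> A" "g \<in> G" "g' \<in> G" "g w = w" "g' w = w" "c s \<circ> g = c s' \<circ> g'"
      then have "s = s'"
        using c by (metis comp_apply)
      moreover have "inj (c s)"
        using c * perm_groupD(2)[OF G] permutes_inj by blast
      moreover have "g u = g' u" for u
        using * calculation by (metis comp_apply injD)
      ultimately show "s = s' \<and> g = g'"
        by auto
    qed
    show "(\<lambda>(s, g). c s \<circ> g) ` (A \<times> ?H) = G"
    proof (intro equalityI subsetI)
      fix g assume g: "g \<in> G"
      then have gw: "g w \<in> A"
        using perm_groupD(2)[OF G] w by (simp add: permutes_in_image)
      obtain k where k: "k \<in> G" "c (g w) \<circ> k = id" "k \<circ> c (g w) = id"
        using perm_group_inverse[OF G] c gw by metis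
      have "(k \<circ> g) w = w"
        using k(3) c[OF gw] by (metis comp_apply id_apply)
      moreover have "g = c (g w) \<circ> (k \<circ> g)"
        using k(2) by (simp add: comp_assoc[symmetric])
      ultimately show "g \<in> (\<lambda>(s, g). c s \<circ> g) ` (A \<times> ?H)"
        using gw perm_groupD(4)[OF G k(1) g] by (intro image_eqI[of _ _ "(g w, k \<circ> g)"]) auto
    qed (use c perm_groupD(4)[OF G] in auto)
  qed
  then have "card G = card (A \<times> ?H)"
    by (rule bij_betw_same_card[symmetric])
  then show ?thesis
    by (simp add: card_cartesian_product)
qed

text \<open>An element fixing some point \<open>s\<close> is conjugate in \<open>G\<close> to one
  fixing \<open>w\<close>, and conjugation preserves the number of fixed points; an element without
  fixed points satisfies any bound.\<close>

lemma fixes_at_most_transitive: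
  assumes G: "perm_group A G" and t: "transitive_on A G" and w: "w \<in> A"
    and H: "fixes_at_most m A {g \<in> G. g w = w}"
  shows "fixes_at_most m A G"
  unfolding fixes_at_most_def
proof (intro ballI impI)
  fix g assume g: "g \<in> G" "g \<noteq> id"
  note G' = perm_groupD[OF G]
  show "card {s \<in> A. g s = s} \<le> m"
  proof (cases "{s \<in> A. g s = s} = {}")
    case False
    then obtain s where s: "s \<in> A" "g s = s" by blast
    obtain c where c: "c \<in> G" "c w = s"
      using t w s by (auto simp: transitive_on_def)
    obtain k where k: "k \<in> G" "c \<circ> k = id" "k \<circ> c = id"
      using perm_group_inverse[OF G c(1)] .
    have ck: "c (k u) = u" and kc: "k (c u) = u" for u
      using k by (metis comp_apply id_apply)+
    let ?g = "k \<circ> g \<circ> c"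
    have "?g \<in> G" "?g w = w"
      using G' g k c s by (auto simp: kc)
    moreover have "?g \<noteq> id"
    proof
      assume "?g = id"
      then have "g u = u" for u
        by (metis ck comp_apply id_apply)
      with g show False by auto
    qed
    ultimately have "card {u \<in> A. ?g u = u} \<le> m"
      using H by (auto simp: fixes_at_most_def)
    moreover have "card {u \<in> A. ?g u = u} = card {u \<in> A. g u = u}"
    proof (rule bij_betw_same_card)
      show "bij_betw c {u \<in> A. ?g u = u} {u \<in> A. g u = u}"
        by (rule bij_betwI[where g = k])
          (use G'(2)[OF c(1)] G'(2)[OF k(1)] in \<open>auto simp: ck kc permutes_in_image\<close>, metis ck)
    qed
    ultimately show ?thesis by simp
  qed (simp only: card.empty)
qed

text \<open>\<open>x\<close> and \<open>y\<close> agree exactly on the fixed points of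
  \<open>k \<circ> x\<close>, where \<open>k\<close> is the inverse of \<open>y\<close>; this is a
  nonidentity element of \<open>G\<close>.\<close>

lemma perm_group_dist:
  assumes G: "perm_group A G" and m: "fixes_at_most m A G"
    and xy: "x \<in> G" "y \<in> G" "x \<noteq> y"
  shows "card A \<le> card {s \<in> A. x s \<noteq> y s} + m"
proof -
  note G' = perm_groupD[OF G]
  obtain k where k: "k \<in> G" "y \<circ> k = id" "k \<circ> y = id"
    using perm_group_inverse[OF G xy(2)] .
  have yk: "y (k u) = u" and ky: "k (y u) = u" for u
    using k by (metis comp_apply id_apply)+
  have "k \<circ> x \<noteq> id"
  proof
    assume "k \<circ> x = id"
    then have "x u = y u" for u
      by (metis comp_apply id_apply yk)
    with xy show False by auto
  qed
  then have "card {s \<in> A. (k \<circ> x) s = s} \<le> m"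
    using m G'(4)[OF k(1) xy(1)] unfolding fixes_at_most_def by blast
  also have "{s \<in> A. (k \<circ> x) s = s} = {s \<in> A. x s = y s}"
    by (auto simp: ky) (metis yk)
  finally have "card {s \<in> A. x s = y s} \<le> m" .
  moreover have "card {s \<in> A. x s \<noteq> y s} + card {s \<in> A. x s = y s} = card A"
    using G'(1) by (subst card_Un_disjoint[symmetric]) (auto intro: arg_cong[where f = card])
  ultimately show ?thesis by linarith
qed

section \<open>Deleting one or two points from a permutation group\<close>

lemma card_vimage_sing_le_one:
  assumes "x permutes A" 
  shows "card {s \<in> B. x s = t} \<le> 1"
proof -
  have "card {s \<in> B. x s = t} \<le> card {inv_into UNIV x t}"
    using permutes_inverses(2)[OF assms] by (intro card_mono) auto
  then show ?thesis by simp
qed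

lemma card_Collect_disj_le: "card {s \<in> B. Q s \<or> R s} \<le> card {s \<in> B. Q s} + card {s \<in> B. R s}"
  using card_Un_le[of "{s \<in> B. Q s}" "{s \<in> B. R s}"] by (simp add: Un_def conj_disj_distribL)

text \<open>At most one unit of distance is lost at \<open>z\<close> itself, and one more for the
  point that each of the two permutations sends to \<open>z\<close>.\<close>

lemma card_le_P_delete_one:
  assumes G: "perm_group A G" and m: "fixes_at_most m A G" and z: "z \<in> A"
    and d: "0 < d" "d + 3 + m \<le> card A"
  shows "card G \<le> P (card A - 1) d"
proof -
  have "card G \<le> P (card (A - {z})) d"
  proof (rule card_le_P_contraction)
    fix x y assume xy: "x \<in> G" "y \<in> G" "x \<noteq> y"
    have "card {s \<in> A - {z}. x s \<in> {z} \<or> y s \<in> {z}} \<le> 1 + 1"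
      unfolding singleton_iff
      by (intro order_trans[OF card_Collect_disj_le] add_mono
          card_vimage_sing_le_one[OF perm_groupD(2)[OF G]] xy)
    moreover have "card {s \<in> {z}. x s \<noteq> y s} \<le> card {z}"
      by (intro card_mono) auto
    ultimately show "d + card {s \<in> {z}. x s \<noteq> y s} + card {s \<in> A - {z}. x s \<in> {z} \<or> y s \<in> {z}}
        \<le> card {s \<in> A. x s \<noteq> y s}"
      using perm_group_dist[OF G m xy] d by simp
  qed (use perm_groupD[OF G] z d in auto)
  then show ?thesis
    using z perm_groupD(1)[OF G] by simp
qed

text \<open>A permutation fixing \<open>z\<close> redirects nothing, one sending \<open>z\<close> to
  \<open>w\<close> at most one point. Two of different kinds lose one unit at \<open>z\<close> and
  one by redirection; two of the second kind agree at \<open>z\<close> and lose two by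
  redirection.\<close>

lemma card_le_P_delete_one_restricted:
  assumes G: "perm_group A G" and m: "fixes_at_most m A G" and z: "z \<in> A"
    and d: "0 < d" "d + 2 + m \<le> card A"
  shows "card {g \<in> G. g z = z \<or> g z = w} \<le> P (card A - 1) d"
proof -
  let ?C = "{g \<in> G. g z = z \<or> g z = w}"
  have "card ?C \<le> P (card (A - {z})) d"
  proof (rule card_le_P_contraction)
    fix x y assume xy: "x \<in> ?C" "y \<in> ?C" "x \<noteq> y"
    have aff: "card {s \<in> A - {z}. u s = z} \<le> (if u z = z then 0 else 1)" if "u \<in> G" for u
    proof (cases "u z = z")
      case True
      moreover have "inj u"
        using perm_groupD(2)[OF G that] by (rule permutes_inj)
      ultimately have empty: "{s \<in> A - {z}. u s = z} = {}"
        by (auto simp: inj_def)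
      show ?thesis unfolding empty by simp
    next
      case False
      show ?thesis
        unfolding if_not_P[OF False] by (rule card_vimage_sing_le_one[OF perm_groupD(2)[OF G that]])
    qed
    have "card {s \<in> A - {z}. x s \<in> {z} \<or> y s \<in> {z}}
        \<le> (if x z = z then 0 else 1) + (if y z = z then 0 else 1)"
      unfolding singleton_iff
      by (intro order_trans[OF card_Collect_disj_le] add_mono) (use xy aff in blast)+
    moreover have "{s \<in> {z}. x s \<noteq> y s} = (if x z = y z then {} else {z})"
      by auto
    then have "card {s \<in> {z}. x s \<noteq> y s} = (if x z = y z then 0 else 1)"
      by simp
    ultimately have "card {s \<in> {z}. x s \<noteq> y s} + card {s \<in> A - {z}. x s \<in> {z} \<or> y s \<in> {z}} \<le> 2"
      using xy by (auto split: if_splits)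
    then show "d + card {s \<in> {z}. x s \<noteq> y s} + card {s \<in> A - {z}. x s \<in> {z} \<or> y s \<in> {z}}
        \<le> card {s \<in> A. x s \<noteq> y s}"
      using perm_group_dist[OF G m, of x y] xy d by simp
  qed (use perm_groupD[OF G] z d in auto)
  then show ?thesis
    using z perm_groupD(1)[OF G] by simp
qed

text \<open>Only the preimages of \<open>u\<close> and \<open>v\<close> land in
  \<open>{u, v}\<close>, and \<open>s\<close> is one of these two preimages while lying outside
  \<open>A - {u, v}\<close>.\<close>

lemma card_affected_le_one:
  assumes x: "x permutes A" and s: "s \<in> {u, v}" "x s \<in> {u, v}"
  shows "card {s \<in> A - {u, v}. x s \<in> {u, v}} \<le> 1"
proof -
  have "{s \<in> A - {u, v}. x s \<in> {u, v}} \<subseteq> {inv_into UNIV x u, inv_into UNIV x v} - {s}"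
  proof
    fix t assume t: "t \<in> {s \<in> A - {u, v}. x s \<in> {u, v}}"
    then have "inv_into UNIV x (x t) \<in> {inv_into UNIV x u, inv_into UNIV x v}"
      by auto
    with s t show "t \<in> {inv_into UNIV x u, inv_into UNIV x v} - {s}"
      by (auto simp: permutes_inverses(2)[OF x])
  qed
  then have "card {s \<in> A - {u, v}. x s \<in> {u, v}} \<le> card ({inv_into UNIV x u, inv_into UNIV x v} - {s})"
    by (intro card_mono) auto
  also have "\<dots> = card {inv_into UNIV x u, inv_into UNIV x v} - 1"
    using s permutes_inverses(2)[OF x, of s] by (subst card_Diff_singleton) auto
  also have "\<dots> \<le> 1"
    using card_insert_le_m1[of 2 "{inv_into UNIV x v}" "inv_into UNIV x u"] by simp
  finally show ?thesis .
qed

text \<open>A permutation fixing \<open>u\<close> redirects at most one point, one swapping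
  \<open>u\<close> and \<open>v\<close> none. Two that fix \<open>u\<close> lose at most 2 by
  redirection and 1 at \<open>v\<close>; one of each kind lose at most 1 and 2; two that swap lose
  nothing.\<close>

lemma card_le_P_delete_two_restricted:
  assumes G: "perm_group A G" and m: "fixes_at_most m A G" and uv: "u \<in> A" "v \<in> A" "u \<noteq> v"
    and d: "0 < d" "d + 3 + m \<le> card A"
  shows "card {g \<in> G. g u = u \<or> g u = v \<and> g v = u} \<le> P (card A - 2) d"
proof -
  let ?C = "{g \<in> G. g u = u \<or> g u = v \<and> g v = u}"
  have "card ?C \<le> P (card (A - {u, v})) d"
  proof (rule card_le_P_contraction)
    fix x y assume xy: "x \<in> ?C" "y \<in> ?C" "x \<noteq> y"
    have aff: "card {s \<in> A - {u, v}. g s \<in> {u, v}} \<le> (if g u = u then 1 else 0)" if "g \<in> ?C" for g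
    proof (cases "g u = u")
      case True
      show ?thesis
        unfolding if_P[OF True] using that True perm_groupD(2)[OF G, of g]
        by (intro card_affected_le_one[of g A u]) auto
    next
      case False
      then have "g u = v" "g v = u"
        using that by auto
      moreover have "inj g"
        using perm_groupD(2)[OF G, of g] that permutes_inj by blast
      ultimately have empty: "{s \<in> A - {u, v}. g s \<in> {u, v}} = {}"
        by (auto simp: inj_def)
      show ?thesis unfolding empty by simp
    qed
    \<comment> \<open>\<open>B\<close> and \<open>C\<close> stand for \<open>x\<close> and
      \<open>y\<close> fixing \<open>u\<close>, \<open>a\<close> for the number of redirected
      points, and \<open>b\<close> for the number of disagreements on \<open>{u, v}\<close>.\<close>
    have "b + a \<le> 3"
      if "a \<le> (if B then 1 else 0) + (if C then 1 else 0)"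
        "b \<le> (if B then if C then 1 else 2 else if C then 2 else 0)" for a b :: nat and B C
      using that by (auto split: if_splits)
    moreover have "card {s \<in> A - {u, v}. x s \<in> {u, v} \<or> y s \<in> {u, v}}
        \<le> (if x u = u then 1 else 0) + (if y u = u then 1 else 0)"
      by (intro order_trans[OF card_Collect_disj_le] add_mono aff xy)
    moreover have "card {s \<in> {u, v}. x s \<noteq> y s}
        \<le> (if x u = u then if y u = u then 1 else 2 else if y u = u then 2 else 0)"
    proof -
      have "card {s \<in> {u, v}. x s \<noteq> y s} \<le> card {v}" if "x u = u" "y u = u"
        using that by (intro card_mono) auto
      moreover have "card {s \<in> {u, v}. x s \<noteq> y s} \<le> card {u, v}"
        by (intro card_mono) auto
      moreover have "{s \<in> {u, v}. x s \<noteq> y s} = {}" if "x u \<noteq> u" "y u \<noteq> u"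
        using xy that by auto
      ultimately show ?thesis
        using uv by (auto simp del: Collect_empty_eq)
    qed
    ultimately have "card {s \<in> {u, v}. x s \<noteq> y s}
        + card {s \<in> A - {u, v}. x s \<in> {u, v} \<or> y s \<in> {u, v}} \<le> 3"
      by blast
    then show "d + card {s \<in> {u, v}. x s \<noteq> y s}
        + card {s \<in> A - {u, v}. x s \<in> {u, v} \<or> y s \<in> {u, v}} \<le> card {s \<in> A. x s \<noteq> y s}"
      using perm_group_dist[OF G m, of x y] xy d by simp
  qed (use perm_groupD[OF G] uv d in auto)
  then show ?thesis
    using uv perm_groupD(1)[OF G] by (simp add: card_Diff_subset numeral_2_eq_2)
qed

text \<open>Two units may be lost at \<open>u\<close> and \<open>v\<close>. Each permutation sends a
  deleted point to a deleted point, which leaves at most one point to redirect.\<close>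

lemma card_le_P_delete_two:
  assumes G: "perm_group A G" and m: "fixes_at_most m A G" and uv: "u \<in> A" "v \<in> A" "u \<noteq> v"
    and d: "0 < d" "d + 4 + m \<le> card A"
  shows "card {g \<in> G. g u \<in> {u, v} \<or> g v \<in> {u, v}} \<le> P (card A - 2) d"
proof -
  let ?C = "{g \<in> G. g u \<in> {u, v} \<or> g v \<in> {u, v}}"
  have "card ?C \<le> P (card (A - {u, v})) d"
  proof (rule card_le_P_contraction)
    fix x y assume xy: "x \<in> ?C" "y \<in> ?C" "x \<noteq> y"
    have aff: "card {s \<in> A - {u, v}. g s \<in> {u, v}} \<le> 1" if "g \<in> ?C" for g
      using that perm_groupD(2)[OF G, of g] card_affected_le_one[of g A u u v]
        card_affected_le_one[of g A v u v] by blast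
    have "card {s \<in> A - {u, v}. x s \<in> {u, v} \<or> y s \<in> {u, v}} \<le> 1 + 1"
      by (intro order_trans[OF card_Collect_disj_le] add_mono aff xy)
    moreover have "card {s \<in> {u, v}. x s \<noteq> y s} \<le> card {u, v}"
      by (intro card_mono) auto
    ultimately show "d + card {s \<in> {u, v}. x s \<noteq> y s}
        + card {s \<in> A - {u, v}. x s \<in> {u, v} \<or> y s \<in> {u, v}} \<le> card {s \<in> A. x s \<noteq> y s}"
      using perm_group_dist[OF G m, of x y] xy d uv(3) by simp
  qed (use perm_groupD[OF G] uv d in auto)
  then show ?thesis
    using uv perm_groupD(1)[OF G] by (simp add: card_Diff_subset numeral_2_eq_2)
qed


section \<open>One-point extensions\<close>

definition double_coset :: "('a \<Rightarrow> 'a) set \<Rightarrow> ('a \<Rightarrow> 'a) \<Rightarrow> ('a \<Rightarrow> 'a) set" where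
  "double_coset G h = {a \<circ> h \<circ> b | a b. a \<in> G \<and> b \<in> G}"

lemma double_coset_mult:
  assumes G: "perm_group A G" and x: "x \<in> double_coset G h" and a: "a \<in> G"
  shows "a \<circ> x \<in> double_coset G h" "x \<circ> a \<in> double_coset G h"
proof -
  obtain c e where ce: "c \<in> G" "e \<in> G" "x = c \<circ> h \<circ> e"
    using x by (auto simp: double_coset_def)
  have "a \<circ> x = (a \<circ> c) \<circ> h \<circ> e" "x \<circ> a = c \<circ> h \<circ> (e \<circ> a)"
    using ce by (auto simp: comp_assoc)
  then show "a \<circ> x \<in> double_coset G h" "x \<circ> a \<in> double_coset G h"
    unfolding double_coset_def using perm_groupD(4)[OF G] ce a by blast+
qed

text \<open>With \<open>trans\<close>, the condition \<open>stab_trans\<close> amounts to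
  2-transitivity of \<open>G\<close>. Every element moving \<open>w\<close> is then a product of
  \<open>g0\<close> with stabiliser elements on both sides, so one condition on \<open>g0\<close>
  suffices.\<close>

locale one_point_extension =
  fixes A :: "'a set" and G :: "('a \<Rightarrow> 'a) set" and w z :: 'a and h g0 :: "'a \<Rightarrow> 'a"
  assumes G: "perm_group A G" and trans: "transitive_on A G"
    and w: "w \<in> A" and z: "z \<notin> A"
    and h: "h permutes insert z A" and hh: "h \<circ> h = id" and hz: "h z = w"
    and normal: "\<And>g. g \<in> G \<Longrightarrow> g w = w \<Longrightarrow> h \<circ> g \<circ> h \<in> G"
    and stab_trans: "\<And>s. s \<in> A \<Longrightarrow> s \<noteq> w \<Longrightarrow> \<exists>a\<in>G. a w = w \<and> a (g0 w) = s"
    and g0: "g0 \<in> G" "h \<circ> g0 \<circ> h \<in> double_coset G h"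
begin

definition "ext = G \<union> double_coset G h"

text \<open>This is the core of closure: a product of two elements of the double coset contains a
  factor of this form.\<close>

lemma conj_in_ext:
  assumes g: "g \<in> G"
  shows "h \<circ> g \<circ> h \<in> ext"
proof (cases "g w = w")
  case True
  then show ?thesis using normal[OF g] by (simp add: ext_def)
next
  case False
  have "g w \<in> A"
    using perm_groupD(2)[OF G g] w by (simp add: permutes_in_image)
  then obtain a where a: "a \<in> G" "a w = w" "a (g0 w) = g w"
    using stab_trans False by blast
  have ag: "a \<circ> g0 \<in> G"
    using perm_groupD(4)[OF G a(1) g0(1)] .
  obtain k where k: "k \<in> G" "(a \<circ> g0) \<circ> k = id" "k \<circ> (a \<circ> g0) = id"
    using perm_group_inverse[OF G ag] .
  let ?b = "k \<circ> g"
  have "?b w = k ((a \<circ> g0) w)"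
    using a by simp
  then have b: "?b w = w"
    using k(3) by (metis comp_apply id_apply)
  have b': "?b \<in> G"
    using perm_groupD(4)[OF G k(1) g] .
  \<comment> \<open>\<open>g\<close> is \<open>a \<circ> g0 \<circ> ?b\<close> with \<open>a\<close>
    and \<open>?b\<close> fixing \<open>w\<close>. Inserting \<open>h \<circ> h\<close> between the
    factors leaves two conjugates lying in \<open>G\<close> around
    \<open>h \<circ> g0 \<circ> h\<close>.\<close>
  have "h \<circ> g \<circ> h = h \<circ> (a \<circ> g0 \<circ> k) \<circ> g \<circ> h"
    unfolding k(2) by simp
  also have "\<dots> = h \<circ> a \<circ> (h \<circ> h) \<circ> g0 \<circ> (h \<circ> h) \<circ> k \<circ> g \<circ> h"
    unfolding hh by (simp add: comp_assoc)
  also have "\<dots> = (h \<circ> a \<circ> h) \<circ> (h \<circ> g0 \<circ> h) \<circ> (h \<circ> ?b \<circ> h)"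
    by (simp only: comp_assoc)
  also have "\<dots> \<in> double_coset G h"
    using normal[OF a(1,2)] normal[OF b' b] g0(2) double_coset_mult[OF G] by blast
  finally show ?thesis by (simp add: ext_def)
qed

lemma perm_group_ext: "perm_group (insert z A) ext"
proof -
  have permG: "x permutes insert z A" if "x \<in> G" for x
    using perm_groupD(2)[OF G that] by (rule permutes_subset) auto
  have "x permutes insert z A" if "x \<in> ext" for x
    using that permG h by (auto simp: ext_def double_coset_def intro!: permutes_compose)
  moreover have "x \<circ> y \<in> ext" if xy: "x \<in> ext" "y \<in> ext" for x y
  proof -
    have ext_mult: "a \<circ> u \<in> ext \<and> u \<circ> a \<in> ext" if "a \<in> G" "u \<in> ext" for a u
      using that double_coset_mult[OF G] perm_groupD(4)[OF G] by (auto simp: ext_def)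
    show ?thesis
    proof (cases "x \<in> G \<or> y \<in> G")
      case True
      then show ?thesis using ext_mult xy by blast
    next
      case False
      then obtain a b c e where *: "a \<in> G" "b \<in> G" "c \<in> G" "e \<in> G"
        "x = a \<circ> h \<circ> b" "y = c \<circ> h \<circ> e"
        using xy by (auto simp: ext_def double_coset_def)
      have "x \<circ> y = a \<circ> (h \<circ> (b \<circ> c) \<circ> h) \<circ> e"
        using * by (simp add: comp_assoc)
      moreover have "h \<circ> (b \<circ> c) \<circ> h \<in> ext"
        using conj_in_ext perm_groupD(4)[OF G] * by blast
      ultimately show ?thesis
        using ext_mult * by metis
    qed
  qed
  ultimately show ?thesis
    using perm_groupD[OF G] by (auto simp: perm_group_def ext_def)
qed

lemma G_fixes_z: "g \<in> G \<Longrightarrow> g z = z"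
  using perm_groupD(2)[OF G] z by (metis permutes_not_in)

text \<open>An element \<open>a \<circ> h \<circ> b\<close> of the double coset sends
  \<open>z\<close> to \<open>a w\<close>, which is a point of \<open>A\<close>.\<close>

lemma ext_stabilizer: "{g \<in> ext. g z = z} = G"
proof -
  have "g z \<noteq> z" if g: "g \<in> double_coset G h" for g
  proof -
    obtain a b where ab: "a \<in> G" "b \<in> G" "g = a \<circ> h \<circ> b"
      using g by (auto simp: double_coset_def)
    have "a w \<in> A"
      using perm_groupD(2)[OF G ab(1)] w by (simp add: permutes_in_image)
    then show ?thesis
      using ab(3) z G_fixes_z[OF ab(2)] hz by (metis comp_apply)
  qed
  then show ?thesis
    using G_fixes_z by (auto simp: ext_def)
qed

lemma h_in_ext: "h \<in> ext"
proof -
  have "h = id \<circ> h \<circ> id" by simp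
  then show ?thesis
    unfolding ext_def double_coset_def using perm_groupD(3)[OF G] by blast
qed

lemma transitive_ext: "transitive_on (insert z A) ext"
proof (rule transitive_onI[OF perm_group_ext, where w = z])
  fix s assume "s \<in> insert z A"
  then consider "s = z" | "s \<in> A" by blast
  then show "\<exists>g\<in>ext. g z = s"
  proof cases
    case 1
    then show ?thesis using perm_groupD(3)[OF perm_group_ext] by (intro bexI[of _ id]) auto
  next
    case 2
    then obtain g where g: "g \<in> G" "g w = s"
      using trans w by (auto simp: transitive_on_def)
    then have "g \<circ> h \<in> ext" "(g \<circ> h) z = s"
      using perm_groupD(4)[OF perm_group_ext] h_in_ext hz by (auto simp: ext_def)
    then show ?thesis by blast
  qed
qed

lemma card_ext: "card ext = Suc (card A) * card G"
  using card_transitive[OF perm_group_ext transitive_ext, of z] z perm_groupD(1)[OF G]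
  by (simp add: ext_stabilizer)

text \<open>The stabiliser of \<open>z\<close> is \<open>G\<close>, whose elements gain just the
  fixed point \<open>z\<close>; transitivity carries the bound to all of \<open>ext\<close>.\<close>

lemma fixes_at_most_ext:
  assumes "fixes_at_most m A G"
  shows "fixes_at_most (Suc m) (insert z A) ext"
proof (rule fixes_at_most_transitive[OF perm_group_ext transitive_ext, of z])
  show "fixes_at_most (Suc m) (insert z A) {g \<in> ext. g z = z}"
    unfolding ext_stabilizer fixes_at_most_def
  proof (intro ballI impI)
    fix g assume g: "g \<in> G" "g \<noteq> id"
    have "card {s \<in> insert z A. g s = s} \<le> card (insert z {s \<in> A. g s = s})"
      using perm_groupD(1)[OF G] by (intro card_mono) auto
    also have "\<dots> \<le> Suc (card {s \<in> A. g s = s})"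
      by (rule card_insert_le_m1) simp_all
    finally show "card {s \<in> insert z A. g s = s} \<le> Suc m"
      using assms g by (fastforce simp: fixes_at_most_def)
  qed
qed simp

text \<open>The elements of \<open>G\<close> fix \<open>z\<close>, and those of the disjoint coset
  of \<open>h\<close> send \<open>z\<close> to \<open>w\<close>.\<close>

lemma card_ext_restricted: "2 * card G \<le> card {g \<in> ext. g z = z \<or> g z = w}"
proof -
  have hG: "(h \<circ> g) z = w" if "g \<in> G" for g
    using G_fixes_z[OF that] hz by simp
  have G_sub: "G \<subseteq> ext" "finite ext"
    using perm_groupD(5)[OF perm_group_ext] by (auto simp: ext_def)
  have w': "w \<noteq> z"
    using w z by auto
  have disj: "G \<inter> (\<circ>) h ` G = {}"
  proof -
    have False if "g \<in> G" "h \<circ> g \<in> G" for g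
      using hG[OF that(1)] G_fixes_z[OF that(2)] w' by simp
    then show ?thesis by blast
  qed
  have "2 * card G = card G + card ((\<circ>) h ` G)"
    using inj_comp_left[OF permutes_inj[OF h], of G] by (simp add: card_image)
  also have "\<dots> = card (G \<union> (\<circ>) h ` G)"
    using disj perm_groupD(5)[OF G] by (simp add: card_Un_disjoint)
  also have "\<dots> \<le> card {g \<in> ext. g z = z \<or> g z = w}"
  proof (rule card_mono)
    show "finite {g \<in> ext. g z = z \<or> g z = w}"
      using G_sub(2) by simp
    have "h \<circ> g \<in> {g \<in> ext. g z = z \<or> g z = w}" if "g \<in> G" for g
      using perm_groupD(4)[OF perm_group_ext h_in_ext, of g] G_sub(1) that hG[OF that] by blast
    then show "G \<union> (\<circ>) h ` G \<subseteq> {g \<in> ext. g z = z \<or> g z = w}"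
      using G_sub(1) G_fixes_z by blast
  qed
  finally show ?thesis .
qed

text \<open>The hypothesis on \<open>g0\<close> for the next extension is met by \<open>h\<close> itself when
  \<open>h\<close> and \<open>h'\<close> satisfy the braid relation.\<close>

lemma next_extension:
  assumes "z' \<notin> insert z A" "h' permutes insert z' (insert z A)" "h' \<circ> h' = id" "h' z' = z"
    and norm: "\<And>g. g \<in> G \<Longrightarrow> h' \<circ> g \<circ> h' \<in> G"
    and braid: "h' \<circ> h \<circ> h' = h \<circ> h' \<circ> h"
  shows "one_point_extension (insert z A) ext z z' h' h"
proof
  show "perm_group (insert z A) ext" "transitive_on (insert z A) ext" "h \<in> ext"
    by (rule perm_group_ext transitive_ext h_in_ext)+
  show "h' \<circ> g \<circ> h' \<in> ext" if "g \<in> ext" "g z = z" for g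
    using norm[of g] that ext_stabilizer by (auto simp: ext_def)
  \<comment> \<open>Here \<open>h z = w\<close>, and \<open>G\<close> fixes \<open>z\<close> and is
    transitive on the old points.\<close>
  show "\<exists>a\<in>ext. a z = z \<and> a (h z) = s" if s: "s \<in> insert z A" "s \<noteq> z" for s
  proof -
    obtain g where "g \<in> G" "g w = s"
      using trans w s by (auto simp: transitive_on_def)
    then show ?thesis
      using G_fixes_z hz by (auto simp: ext_def)
  qed
  show "h' \<circ> h \<circ> h' \<in> double_coset ext h'"
    unfolding braid double_coset_def using h_in_ext by blast
qed (use assms in auto)

text \<open>An involution that normalises \<open>G\<close> and commutes with \<open>h\<close>
  normalises the double coset too. This supplies the normality hypothesis when
  \<open>next_extension\<close> is used a second time.\<close>

lemma conj_ext:
  assumes norm: "\<And>g. g \<in> G \<Longrightarrow> k \<circ> g \<circ> k \<in> G" and "k \<circ> k = id" and comm: "k \<circ> h = h \<circ> k"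
    and g: "g \<in> ext"
  shows "k \<circ> g \<circ> k \<in> ext"
proof (cases "g \<in> G")
  case True
  then show ?thesis using norm by (simp add: ext_def)
next
  case False
  then obtain a b where ab: "a \<in> G" "b \<in> G" "g = a \<circ> h \<circ> b"
    using g by (auto simp: ext_def double_coset_def)
  have "k \<circ> g \<circ> k = k \<circ> a \<circ> h \<circ> (k \<circ> k) \<circ> b \<circ> k"
    using assms(2) ab by (simp add: comp_assoc)
  also have "\<dots> = k \<circ> a \<circ> (h \<circ> k) \<circ> k \<circ> b \<circ> k"
    by (simp only: comp_assoc)
  also have "\<dots> = (k \<circ> a \<circ> k) \<circ> h \<circ> (k \<circ> b \<circ> k)"
    unfolding comm[symmetric] by (simp only: comp_assoc)
  finally show ?thesis
    unfolding ext_def double_coset_def using norm ab by blast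
qed

end


section \<open>The Mathieu group on 12 points\<close>

text \<open>One-line notation turns identities between permutations into list equations that can be
  evaluated.\<close>

definition list_perm :: "nat list \<Rightarrow> nat \<Rightarrow> nat" where
  "list_perm xs i = (if i < length xs then xs ! i else i)"

lemma list_perm_upt: "list_perm [0..<n] = id"
  by (auto simp: list_perm_def fun_eq_iff)

lemma list_perm_comp:
  assumes "length xs = length ys" "\<forall>i\<in>set ys. i < length xs"
  shows "list_perm xs \<circ> list_perm ys = list_perm (map ((!) xs) ys)"
  using assms by (auto simp: list_perm_def fun_eq_iff)

lemma list_perm_permutes:
  assumes "distinct xs" "set xs = {..<length xs}" "{i. i < length xs \<and> xs ! i \<noteq> i} \<subseteq> A"
  shows "list_perm xs permutes A"
proof (rule permutes_superset)
  show "list_perm xs permutes {..<length xs}"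
  proof (rule bij_imp_permutes)
    show "bij_betw (list_perm xs) {..<length xs} {..<length xs}"
      using bij_betw_nth[OF assms(1) refl assms(2)[symmetric]]
      by (subst bij_betw_cong[of _ _ "(!) xs"]) (auto simp: list_perm_def)
  qed (simp add: list_perm_def)
qed (use assms in \<open>auto simp: list_perm_def\<close>)

text \<open>The points \<open>0,\<dots>,8\<close> stand for the field of nine elements, the point \<open>a + 3 * b\<close>
  being \<open>a + b * i\<close> with \<open>i * i = - 1\<close>. The lists below are the maps \<open>x \<mapsto> x + c\<close> and the
  maps \<open>x \<mapsto> c * x\<close> (\<open>c\<close> a nonzero square) and \<open>x \<mapsto> c * x^3\<close> (\<open>c\<close> a nonsquare).\<close>

definition gf9_translations :: "nat list list" where
  "gf9_translations =
    [[0,1,2,3,4,5,6,7,8,9,10,11], [1,2,0,4,5,3,7,8,6,9,10,11], [2,0,1,5,3,4,8,6,7,9,10,11],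
     [3,4,5,6,7,8,0,1,2,9,10,11], [4,5,3,7,8,6,1,2,0,9,10,11], [5,3,4,8,6,7,2,0,1,9,10,11],
     [6,7,8,0,1,2,3,4,5,9,10,11], [7,8,6,1,2,0,4,5,3,9,10,11], [8,6,7,2,0,1,5,3,4,9,10,11]]"

definition gf9_quaternions :: "nat list list" where
  "gf9_quaternions =
    [[0,1,2,3,4,5,6,7,8,9,10,11], [0,2,1,6,8,7,3,5,4,9,10,11], [0,3,6,2,5,8,1,4,7,9,10,11],
     [0,6,3,1,7,4,2,8,5,9,10,11], [0,4,8,7,2,3,5,6,1,9,10,11], [0,5,7,4,6,2,8,1,3,9,10,11],
     [0,7,5,8,3,1,4,2,6,9,10,11], [0,8,4,5,1,6,7,3,2,9,10,11]]"

text \<open>On the field of nine elements these are the maps \<open>1 / x\<close>, \<open>i * x + (1 - i) * x^3\<close> and \<open>x^3\<close>.\<close>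

definition "swap_0_9 = [9,1,2,6,5,4,3,8,7,0,10,11::nat]"
definition "swap_9_10 = [0,1,2,7,8,6,5,3,4,10,9,11::nat]"
definition "swap_10_11 = [0,1,2,6,7,8,3,4,5,9,11,10::nat]"

abbreviation lcomp :: "nat list \<Rightarrow> nat list \<Rightarrow> nat list" where
  "lcomp xs ys \<equiv> map ((!) xs) ys"

text \<open>All quantifiers run over lists, so that evaluation decides the property. Having length
  12 and containing all 12 points forces the list to be a permutation.\<close>

definition perm_list :: "nat \<Rightarrow> nat list \<Rightarrow> bool" where
  "perm_list n xs \<longleftrightarrow> length xs = 12 \<and> (\<forall>i\<in>set [0..<12]. i \<in> set xs)
    \<and> (\<forall>i\<in>set [n..<12]. xs ! i = i)"

lemma perm_listD:
  assumes "perm_list n xs"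
  shows "length xs = 12" "set xs = {..<12}" "list_perm xs permutes {..<n}"
proof -
  show len: "length xs = 12"
    using assms by (simp add: perm_list_def)
  have sub: "{..<12} \<subseteq> set xs"
    using assms by (auto simp: perm_list_def)
  have "card (set xs) \<le> card {..<12::nat}"
    using card_length[of xs] len by simp
  with sub show set: "set xs = {..<12}"
    by (metis card_seteq List.finite_set)
  have "distinct xs"
    using set len by (simp add: card_distinct)
  then show "list_perm xs permutes {..<n}"
    using assms set len by (intro list_perm_permutes) (force simp: perm_list_def)+
qed

lemma perm_list_lcomp:
  assumes "perm_list m xs" "perm_list n ys"
  shows "list_perm xs \<circ> list_perm ys = list_perm (lcomp xs ys)"
  using perm_listD[OF assms(1)] perm_listD[OF assms(2)] by (intro list_perm_comp) auto

lemma list_perm_nth: "perm_list n xs \<Longrightarrow> i < 12 \<Longrightarrow> list_perm xs i = xs ! i"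
  using perm_listD(1) by (simp add: list_perm_def)

section \<open>Finite checks over the field of nine elements\<close>

lemma gf9_perm_list: "\<forall>p\<in>set gf9_translations \<union> set gf9_quaternions. perm_list 9 p"
  by code_simp

lemma swap_perm_list:
  "perm_list 10 swap_0_9" "perm_list 11 swap_9_10" "perm_list 12 swap_10_11"
  by code_simp+

lemma gf9_id: "[0..<12] \<in> set gf9_translations" "[0..<12] \<in> set gf9_quaternions"
  by code_simp+

lemma gf9_quaternions_mult:
  "\<forall>p\<in>set gf9_quaternions. \<forall>q\<in>set gf9_quaternions. lcomp p q \<in> set gf9_quaternions"
  by code_simp

lemma gf9_translations_add:
  "\<forall>p\<in>set gf9_translations. \<forall>q\<in>set gf9_translations. lcomp p q \<in> set gf9_translations"
  by code_simp

text \<open>The quaternion group normalises the translations, so that translations can be moved to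
  the left in products.\<close>

lemma gf9_commute:
  "\<forall>q\<in>set gf9_quaternions. \<forall>t\<in>set gf9_translations. \<exists>t'\<in>set gf9_translations. lcomp q t = lcomp t' q"
  by code_simp

lemma gf9_translations_transitive: "\<forall>s\<in>set [0..<9]. \<exists>t\<in>set gf9_translations. t ! 0 = s"
  by code_simp

lemma gf9_translations_regular: "\<forall>t\<in>set gf9_translations. t ! 0 = 0 \<longrightarrow> t = [0..<12]"
  by code_simp

lemma gf9_quaternions_zero: "\<forall>q\<in>set gf9_quaternions. q ! 0 = 0"
  by code_simp

lemma gf9_quaternions_transitive: "\<forall>s\<in>set [1..<9]. \<exists>q\<in>set gf9_quaternions. q ! 1 = s"
  by code_simp

lemma gf9_quaternions_inj:
  "\<forall>p\<in>set gf9_quaternions. \<forall>q\<in>set gf9_quaternions. p ! 1 = q ! 1 \<longrightarrow> p = q"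
  by code_simp

lemma gf9_quaternions_free:
  "\<forall>q\<in>set gf9_quaternions. q = [0..<12] \<or> (\<forall>s\<in>set [1..<9]. q ! s \<noteq> s)"
  by code_simp

lemma swap_conj_quaternions:
  "\<forall>h\<in>set [swap_0_9, swap_9_10, swap_10_11]. \<forall>q\<in>set gf9_quaternions.
     lcomp (lcomp h q) h \<in> set gf9_quaternions"
  by code_simp

lemma swap_conj_translations:
  "\<forall>h\<in>set [swap_9_10, swap_10_11]. \<forall>t\<in>set gf9_translations.
     lcomp (lcomp h t) h \<in> set gf9_translations"
  by code_simp

lemma swap_involution: "\<forall>h\<in>set [swap_0_9, swap_9_10, swap_10_11]. lcomp h h = [0..<12]"
  by code_simp

text \<open>The two braid relations serve \<open>next_extension\<close>; the commutation serves
  \<open>conj_ext\<close>.\<close>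

lemma swap_relations:
  "lcomp (lcomp swap_9_10 swap_0_9) swap_9_10 = lcomp (lcomp swap_0_9 swap_9_10) swap_0_9"
  "lcomp (lcomp swap_10_11 swap_9_10) swap_10_11 = lcomp (lcomp swap_9_10 swap_10_11) swap_9_10"
  "lcomp swap_10_11 swap_0_9 = lcomp swap_0_9 swap_10_11"
  by code_simp+

text \<open>The semidirect product of the nine translations with a quaternion group of order 8 that
  is regular on the nonzero points: a sharply 2-transitive group of order 72.\<close>

definition M9 :: "(nat \<Rightarrow> nat) set" where
  "M9 = {list_perm t \<circ> list_perm q | t q. t \<in> set gf9_translations \<and> q \<in> set gf9_quaternions}"

lemma gf9_perms:
  "t \<in> set gf9_translations \<Longrightarrow> perm_list 9 t" "q \<in> set gf9_quaternions \<Longrightarrow> perm_list 9 q"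
  using gf9_perm_list by auto

lemma gf9_nth:
  "t \<in> set gf9_translations \<Longrightarrow> i < 12 \<Longrightarrow> list_perm t i = t ! i"
  "q \<in> set gf9_quaternions \<Longrightarrow> i < 12 \<Longrightarrow> list_perm q i = q ! i"
  using list_perm_nth gf9_perms by blast+

lemma M9I: "t \<in> set gf9_translations \<Longrightarrow> q \<in> set gf9_quaternions \<Longrightarrow> list_perm t \<circ> list_perm q \<in> M9"
  by (auto simp: M9_def)

lemma quaternion_in_M9: "q \<in> set gf9_quaternions \<Longrightarrow> list_perm q \<in> M9"
  using M9I[OF gf9_id(1)] by (simp add: list_perm_upt)

lemma translation_in_M9: "t \<in> set gf9_translations \<Longrightarrow> list_perm t \<in> M9"
  using M9I[OF _ gf9_id(2)] by (simp add: list_perm_upt)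

lemma perm_group_M9: "perm_group {..<9} M9"
  unfolding perm_group_def
proof (intro conjI ballI)
  show "x permutes {..<9}" if "x \<in> M9" for x
    using that gf9_perms[THEN perm_listD(3)] by (auto simp: M9_def intro!: permutes_compose)
  show "id \<in> M9"
    using quaternion_in_M9[OF gf9_id(2)] by (simp add: list_perm_upt)
  fix x y assume "x \<in> M9" "y \<in> M9"
  then obtain t q t' q' where *: "t \<in> set gf9_translations" "t' \<in> set gf9_translations"
    "q \<in> set gf9_quaternions" "q' \<in> set gf9_quaternions"
    "x = list_perm t \<circ> list_perm q" "y = list_perm t' \<circ> list_perm q'"
    by (auto simp: M9_def)
  obtain t'' where t'': "t'' \<in> set gf9_translations" "lcomp q t' = lcomp t'' q"
    using gf9_commute * by blast
  have "list_perm q \<circ> list_perm t' = list_perm t'' \<circ> list_perm q"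
    using t'' * gf9_perms perm_list_lcomp by metis
  then have "x \<circ> y = (list_perm t \<circ> list_perm t'') \<circ> (list_perm q \<circ> list_perm q')"
    unfolding * by (metis comp_assoc)
  also have "\<dots> = list_perm (lcomp t t'') \<circ> list_perm (lcomp q q')"
    using t'' * gf9_perms perm_list_lcomp by metis
  also have "\<dots> \<in> M9"
    using t'' * gf9_translations_add gf9_quaternions_mult by (intro M9I) blast+
  finally show "x \<circ> y \<in> M9" .
qed simp

lemma transitive_M9: "transitive_on {..<9} M9"
proof (rule transitive_onI[OF perm_group_M9, where w = 0])
  fix s :: nat assume "s \<in> {..<9}"
  then have "s \<in> set [0..<9]"
    by simp
  then obtain t where t: "t \<in> set gf9_translations" "t ! 0 = s"
    using gf9_translations_transitive by blast
  then have "list_perm t 0 = s"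
    by (simp add: gf9_nth)
  with translation_in_M9[OF t(1)] show "\<exists>g\<in>M9. g 0 = s" by blast
qed

text \<open>The quaternion part fixes \<open>0\<close>, and only the identity translation
  does.\<close>

lemma M9_stabilizer: "{g \<in> M9. g 0 = 0} = list_perm ` set gf9_quaternions"
proof (intro equalityI subsetI)
  fix g assume "g \<in> {g \<in> M9. g 0 = 0}"
  then obtain t q where *: "t \<in> set gf9_translations" "q \<in> set gf9_quaternions"
    "g = list_perm t \<circ> list_perm q" "g 0 = 0"
    by (auto simp: M9_def)
  then have "t ! 0 = 0"
    using gf9_quaternions_zero by (simp add: gf9_nth)
  then have "t = [0..<12]"
    using gf9_translations_regular * by blast
  then show "g \<in> list_perm ` set gf9_quaternions"
    using * by (simp add: list_perm_upt)
qed (use gf9_quaternions_zero quaternion_in_M9 in \<open>auto simp: gf9_nth\<close>)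

lemma card_M9: "card M9 = 72"
proof -
  have "inj_on list_perm (set gf9_quaternions)"
  proof (rule inj_onI)
    fix p q assume pq: "p \<in> set gf9_quaternions" "q \<in> set gf9_quaternions" "list_perm p = list_perm q"
    then have "p ! 1 = q ! 1"
      using gf9_nth(2)[of p 1] gf9_nth(2)[of q 1] by simp
    then show "p = q"
      using pq gf9_quaternions_inj by blast
  qed
  moreover have "card (set gf9_quaternions) = 8"
    by code_simp
  ultimately have "card {g \<in> M9. g 0 = 0} = 8"
    by (simp add: M9_stabilizer card_image)
  then show ?thesis
    using card_transitive[OF perm_group_M9 transitive_M9, of 0] by simp
qed

lemma fixes_at_most_M9: "fixes_at_most 1 {..<9} M9"
proof (rule fixes_at_most_transitive[OF perm_group_M9 transitive_M9, of 0])
  show "fixes_at_most 1 {..<9} {g \<in> M9. g 0 = 0}"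
    unfolding M9_stabilizer fixes_at_most_def
  proof (intro ballI impI)
    fix g assume "g \<in> list_perm ` set gf9_quaternions" "g \<noteq> id"
    then obtain q where q: "q \<in> set gf9_quaternions" "g = list_perm q" "q \<noteq> [0..<12]"
      using list_perm_upt by blast
    then have "\<forall>s\<in>set [1..<9]. q ! s \<noteq> s"
      using gf9_quaternions_free by blast
    then have "{s \<in> {..<9}. g s = s} \<subseteq> {0}"
      using q by (force simp: gf9_nth Suc_le_eq)
    then show "card {s \<in> {..<9}. g s = s} \<le> 1"
      using card_mono[of "{0::nat}"] by fastforce
  qed
qed simp

section \<open>The extensions to 10, 11 and 12 points\<close>

abbreviation "h1 \<equiv> list_perm swap_0_9"
abbreviation "h2 \<equiv> list_perm swap_9_10"
abbreviation "h3 \<equiv> list_perm swap_10_11"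

lemma list_perm_conj:
  assumes "perm_list m h" "perm_list n p"
  shows "list_perm h \<circ> list_perm p \<circ> list_perm h = list_perm (lcomp (lcomp h p) h)"
proof -
  have "\<forall>i\<in>set h. i < length (lcomp h p)"
    using perm_listD[OF assms(1)] perm_listD[OF assms(2)] by simp
  then show ?thesis
    using perm_listD[OF assms(1)] perm_listD[OF assms(2)]
    by (simp add: perm_list_lcomp[OF assms] list_perm_comp)
qed

lemma swap_comp_self:
  "h1 \<circ> h1 = id" "h2 \<circ> h2 = id" "h3 \<circ> h3 = id"
  using swap_involution
  by (simp_all add: perm_list_lcomp[OF swap_perm_list(1) swap_perm_list(1)]
      perm_list_lcomp[OF swap_perm_list(2) swap_perm_list(2)]
      perm_list_lcomp[OF swap_perm_list(3) swap_perm_list(3)] list_perm_upt del: upt_Suc upt_conv_Cons_Cons)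

text \<open>The swap normalises translations and quaternions separately; inserting its square
  between the two factors of \<open>g\<close> combines these facts.\<close>

lemma conj_M9:
  assumes h: "h \<in> set [swap_9_10, swap_10_11]" and g: "g \<in> M9"
  shows "list_perm h \<circ> g \<circ> list_perm h \<in> M9"
proof -
  obtain t q where *: "t \<in> set gf9_translations" "q \<in> set gf9_quaternions"
    "g = list_perm t \<circ> list_perm q"
    using g by (auto simp: M9_def)
  have hh: "list_perm h \<circ> list_perm h = id"
    using h swap_comp_self by auto
  obtain n where hn: "perm_list n h"
    using h swap_perm_list by auto
  have "list_perm h \<circ> g \<circ> list_perm h
      = list_perm h \<circ> list_perm t \<circ> (list_perm h \<circ> list_perm h) \<circ> list_perm q \<circ> list_perm h"
    unfolding hh * by (simp add: comp_assoc)
  also have "\<dots> = (list_perm h \<circ> list_perm t \<circ> list_perm h) \<circ> (list_perm h \<circ> list_perm q \<circ> list_perm h)"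
    by (simp only: comp_assoc)
  also have "\<dots> \<in> M9"
    unfolding list_perm_conj[OF hn gf9_perms(1)[OF *(1)]] list_perm_conj[OF hn gf9_perms(2)[OF *(2)]]
    using swap_conj_translations swap_conj_quaternions h * by (intro M9I) auto
  finally show ?thesis .
qed

interpretation M10: one_point_extension "{..<9}" M9 0 9 h1 "list_perm (gf9_translations ! 1)"
proof
  show "h1 permutes insert 9 {..<9}"
    using perm_listD(3)[OF swap_perm_list(1)] by (simp add: lessThan_nat_numeral lessThan_Suc)
  show "h1 9 = 0"
    by (simp add: list_perm_def swap_0_9_def)
  show "h1 \<circ> g \<circ> h1 \<in> M9" if g: "g \<in> M9" "g 0 = 0" for g
  proof -
    obtain q where q: "q \<in> set gf9_quaternions" "g = list_perm q"
      using g M9_stabilizer by blast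
    then show ?thesis
      using list_perm_conj[OF swap_perm_list(1) gf9_perms(2)] swap_conj_quaternions quaternion_in_M9
      by simp
  qed
  show "list_perm (gf9_translations ! 1) \<in> M9"
    by (rule translation_in_M9) (simp add: gf9_translations_def)
  have one: "list_perm (gf9_translations ! 1) 0 = 1"
    by (simp add: list_perm_def gf9_translations_def)
  show "\<exists>a\<in>M9. a 0 = 0 \<and> a (list_perm (gf9_translations ! 1) 0) = s"
    if "s \<in> {..<9}" "s \<noteq> 0" for s
  proof -
    have "s \<in> set [1..<9]"
      using that by auto
    then obtain q where q: "q \<in> set gf9_quaternions" "q ! 1 = s"
      using gf9_quaternions_transitive by blast
    then show ?thesis
      unfolding one using gf9_quaternions_zero quaternion_in_M9
      by (intro bexI[of _ "list_perm q"]) (auto simp: gf9_nth)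
  qed
  \<comment> \<open>With \<open>9\<close> as infinity, \<open>?a\<close> is \<open>x + 1\<close>,
    \<open>h1\<close> is \<open>1 / x\<close> and \<open>?b\<close> is
    \<open>- x + 2 = - x - 1\<close>. The identity is
    \<open>1 / (1 / x + 1) = 1 + 1 / (- x - 1)\<close>.\<close>
  let ?a = "list_perm (gf9_translations ! 1)"
  let ?b = "list_perm (gf9_translations ! 2) \<circ> list_perm (gf9_quaternions ! 1)"
  have "lcomp (lcomp swap_0_9 (gf9_translations ! 1)) swap_0_9 =
      lcomp (gf9_translations ! 1) (lcomp swap_0_9 (lcomp (gf9_translations ! 2) (gf9_quaternions ! 1)))"
    by code_simp
  then have "h1 \<circ> ?a \<circ> h1 = ?a \<circ> h1 \<circ> ?b"
    by (simp add: list_perm_comp swap_0_9_def gf9_translations_def gf9_quaternions_def comp_assoc)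
  moreover have "?a \<in> M9" "?b \<in> M9"
    by (auto intro!: M9I translation_in_M9 simp: gf9_translations_def gf9_quaternions_def)
  ultimately show "h1 \<circ> ?a \<circ> h1 \<in> double_coset M9 h1"
    unfolding double_coset_def by blast
qed (use perm_group_M9 transitive_M9 swap_comp_self in simp_all)

interpretation M11: one_point_extension "insert 9 {..<9}" M10.ext 9 10 h2 h1
proof (rule M10.next_extension)
  show "h2 permutes insert 10 (insert 9 {..<9})"
    using perm_listD(3)[OF swap_perm_list(2)] by (simp add: lessThan_nat_numeral lessThan_Suc)
  show "h2 10 = 9"
    by (simp add: list_perm_def swap_9_10_def)
  show "h2 \<circ> h1 \<circ> h2 = h1 \<circ> h2 \<circ> h1"
    unfolding list_perm_conj[OF swap_perm_list(2) swap_perm_list(1)]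
      list_perm_conj[OF swap_perm_list(1) swap_perm_list(2)] swap_relations ..
qed (use swap_comp_self conj_M9 in simp_all)

interpretation M12: one_point_extension "insert 10 (insert 9 {..<9})" M11.ext 10 11 h3 h2
proof (rule M11.next_extension)
  show "h3 permutes insert 11 (insert 10 (insert 9 {..<9}))"
    using perm_listD(3)[OF swap_perm_list(3)] by (simp add: lessThan_nat_numeral lessThan_Suc)
  show "h3 11 = 10"
    by (simp add: list_perm_def swap_10_11_def)
  show "h3 \<circ> h2 \<circ> h3 = h2 \<circ> h3 \<circ> h2"
    unfolding list_perm_conj[OF swap_perm_list(3) swap_perm_list(2)]
      list_perm_conj[OF swap_perm_list(2) swap_perm_list(3)] swap_relations ..
  \<comment> \<open>\<open>M10.ext\<close> is built from \<open>M9\<close>, which \<open>h3\<close>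
    normalises, and \<open>h1\<close>, with which \<open>h3\<close> commutes.\<close>
  show "h3 \<circ> g \<circ> h3 \<in> M10.ext" if "g \<in> M10.ext" for g
  proof (rule M10.conj_ext[OF _ swap_comp_self(3) _ that])
    show "h3 \<circ> h1 = h1 \<circ> h3"
      unfolding perm_list_lcomp[OF swap_perm_list(3) swap_perm_list(1)]
        perm_list_lcomp[OF swap_perm_list(1) swap_perm_list(3)] swap_relations ..
  qed (simp add: conj_M9)
qed (use swap_comp_self in simp_all)

text \<open>Each of the three extensions raises the bound 1 for \<open>M9\<close> by one.\<close>

lemma fixes_at_most_M12: "fixes_at_most 4 (insert 11 (insert 10 (insert 9 {..<9}))) M12.ext"
  using M12.fixes_at_most_ext[OF M11.fixes_at_most_ext[OF M10.fixes_at_most_ext[OF fixes_at_most_M9]]]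
  by (simp add: eval_nat_numeral)

text \<open>The group has \<open>12 * 11 * 10 * 72 = 95040\<close> elements, and
  \<open>5 + 3 + 4 = 12\<close>.\<close>

lemma P_11_5: "95040 \<le> P 11 5"
  using card_le_P_delete_one[OF M12.perm_group_ext fixes_at_most_M12, of 11 5]
  by (simp add: M12.card_ext M11.card_ext M10.card_ext card_M9)

text \<open>Twice the order of \<open>M11.ext\<close> is \<open>2 * 11 * 10 * 72 = 15840\<close>,
  and \<open>6 + 2 + 4 = 12\<close>.\<close>

lemma P_11_6: "15840 \<le> P 11 6"
  using card_le_P_delete_one_restricted[OF M12.perm_group_ext fixes_at_most_M12, of 11 6 10]
    M12.card_ext_restricted
  by (simp add: M11.card_ext M10.card_ext card_M9)


section \<open>Finite fields\<close>

lemma (in cring) add_pow_eq_one_mult: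
  "x \<in> carrier R \<Longrightarrow> [(n::nat)] \<cdot> x = ([n] \<cdot> \<one>) \<otimes> x"
  by (simp add: add_pow_ldistr)

lemma (in cring) binomial:
  assumes xy: "x \<in> carrier R" "y \<in> carrier R"
  shows "(x \<oplus> y) [^] (n::nat) = (\<Oplus>i\<in>{..n}. [(n choose i)] \<cdot> (x [^] i \<otimes> y [^] (n - i)))"
proof (induction n)
  case 0
  then show ?case using xy by simp
next
  case (Suc n)
  let ?t = "\<lambda>i. x [^] i \<otimes> y [^] (Suc n - i)"
  have t: "?t i \<in> carrier R" for i
    using xy by simp
  have shift: "(\<Oplus>i\<in>{..Suc n}. f i) = (\<Oplus>i\<in>{..n}. f (Suc i)) \<oplus> f 0"
    if "\<And>i. f i \<in> carrier R" for f :: "nat \<Rightarrow> 'a"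
    using that by (subst finsum_Suc2) auto
  have "(\<Oplus>i\<in>{..n}. [(n choose i)] \<cdot> (x [^] i \<otimes> y [^] (n - i))) \<otimes> x
      = (\<Oplus>i\<in>{..n}. [(n choose i)] \<cdot> ?t (Suc i))"
    using xy by (subst finsum_ldistr) (auto intro!: finsum_cong' simp: add_pow_rdistr m_ac)
  moreover have "(\<Oplus>i\<in>{..n}. [(n choose i)] \<cdot> (x [^] i \<otimes> y [^] (n - i))) \<otimes> y
      = (\<Oplus>i\<in>{..n}. [(n choose i)] \<cdot> ?t i)"
    using xy by (subst finsum_ldistr)
      (auto intro!: finsum_cong' simp: add_pow_rdistr m_ac Suc_diff_le)
  \<comment> \<open>The added term vanishes because \<open>n choose Suc n = 0\<close>; the longer
    sum can be shifted to meet the other one under Pascal's rule.\<close>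
  moreover have "(\<Oplus>i\<in>{..n}. [(n choose i)] \<cdot> ?t i) = (\<Oplus>i\<in>{..Suc n}. [(n choose i)] \<cdot> ?t i)"
    using t by (subst finsum_Suc) (auto simp: binomial_eq_0 simp del: nat_pow_Suc)
  moreover have "\<dots> = (\<Oplus>i\<in>{..n}. [(n choose Suc i)] \<cdot> ?t (Suc i)) \<oplus> ?t 0"
    using t xy by (subst shift) auto
  ultimately have "(x \<oplus> y) [^] Suc n = (\<Oplus>i\<in>{..n}. [(n choose i)] \<cdot> ?t (Suc i))
      \<oplus> ((\<Oplus>i\<in>{..n}. [(n choose Suc i)] \<cdot> ?t (Suc i)) \<oplus> ?t 0)"
    using Suc xy by (simp add: r_distr)
  also have "\<dots> = (\<Oplus>i\<in>{..n}. [(n choose i)] \<cdot> ?t (Suc i) \<oplus> [(n choose Suc i)] \<cdot> ?t (Suc i)) \<oplus> ?t 0"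
    using t xy by (subst finsum_addf) (auto simp: a_assoc)
  also have "\<dots> = (\<Oplus>i\<in>{..n}. [(Suc n choose Suc i)] \<cdot> ?t (Suc i)) \<oplus> ?t 0"
    using t xy by (simp add: add.nat_pow_mult)
  also have "\<dots> = (\<Oplus>i\<in>{..Suc n}. [(Suc n choose i)] \<cdot> ?t i)"
    using t xy by (subst shift) auto
  finally show ?case .
qed

text \<open>The prime \<open>p\<close> divides every binomial coefficient strictly between the two
  ends.\<close>

lemma (in cring) freshmans_dream:
  fixes p :: nat
  assumes p: "Factorial_Ring.prime p" and char: "[p] \<cdot> \<one> = \<zero>" and xy: "x \<in> carrier R" "y \<in> carrier R"
  shows "(x \<oplus> y) [^] p = x [^] p \<oplus> y [^] p"
proof -
  let ?t = "\<lambda>i. [(p choose i)] \<cdot> (x [^] i \<otimes> y [^] (p - i))"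
  have t: "?t i \<in> carrier R" for i
    using xy by simp
  have vanish: "?t i = \<zero>" if i: "0 < i" "i < p" for i
  proof -
    have "p dvd p choose i"
      using p i by (intro dvd_choose_prime) auto
    then obtain c where "p choose i = p * c" ..
    then have "?t i = [c] \<cdot> ([p] \<cdot> (x [^] i \<otimes> y [^] (p - i)))"
      using xy by (simp add: add.nat_pow_pow)
    also have "[p] \<cdot> (x [^] i \<otimes> y [^] (p - i)) = \<zero>"
      using xy char by (subst add_pow_eq_one_mult) auto
    finally show ?thesis by simp
  qed
  obtain n where n: "p = Suc n" "0 < n"
    using prime_gt_1_nat[OF p] by (cases p) auto
  have "(\<Oplus>i\<in>{..p}. ?t i) = ?t p \<oplus> (\<Oplus>i\<in>{..n}. ?t i)"
    unfolding n using t[unfolded n] by (subst finsum_Suc) auto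
  also have "(\<Oplus>i\<in>{..n}. ?t i) = (\<Oplus>i\<in>{..n}. if 0 = i then ?t 0 else \<zero>)"
    using t xy vanish n by (intro finsum_cong') auto
  also have "\<dots> = ?t 0"
    using t[of 0] by (subst finsum_singleton) auto
  finally show ?thesis
    using xy by (simp add: binomial)
qed

lemma (in cring) freshmans_dream_pow:
  fixes p :: nat
  assumes p: "Factorial_Ring.prime p" and char: "[p] \<cdot> \<one> = \<zero>" and xy: "x \<in> carrier R" "y \<in> carrier R"
  shows "(x \<oplus> y) [^] (p ^ k) = x [^] (p ^ k) \<oplus> y [^] (p ^ k)"
proof (induction k)
  case (Suc k)
  have "(x \<oplus> y) [^] (p ^ Suc k) = ((x \<oplus> y) [^] (p ^ k)) [^] p"
    using xy by (simp add: nat_pow_pow mult.commute)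
  also have "\<dots> = x [^] (p ^ Suc k) \<oplus> y [^] (p ^ Suc k)"
    using xy by (simp add: Suc freshmans_dream[OF p char] nat_pow_pow mult.commute)
  finally show ?case .
qed (use xy in simp)

lemma (in ring_hom_ring) hom_add_pow:
  "x \<in> carrier R \<Longrightarrow> h (add_pow R (n::nat) x) = add_pow S n (h x)"
  by (induction n) simp_all

section \<open>The roots of \<open>X^q - X\<close>\<close>

definition (in ring) frobenius_poly :: "nat \<Rightarrow> 'a list" where
  "frobenius_poly q = X [^]\<^bsub>poly_ring R\<^esub> q \<ominus>\<^bsub>poly_ring R\<^esub> X"

lemma (in field) frobenius_poly_properties:
  assumes "1 < q"
  shows "frobenius_poly q \<in> carrier (poly_ring R)" "degree (frobenius_poly q) = q"
    "is_root (frobenius_poly q) x \<longleftrightarrow> x \<in> carrier R \<and> x [^] q = x"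
proof -
  interpret UP: domain "poly_ring R"
    using univ_poly_is_domain[OF carrier_is_subring] .
  note X = var_closed(1)[OF carrier_is_subring]
  show c: "frobenius_poly q \<in> carrier (poly_ring R)"
    unfolding frobenius_poly_def using X by simp
  have "degree (X [^]\<^bsub>poly_ring R\<^esub> q) = q"
    by (simp add: unitary_monom_eq_var_pow[OF carrier_is_subring, symmetric] monom_def)
  moreover have "degree (\<ominus>\<^bsub>poly_ring R\<^esub> X) = 1"
    using X univ_poly_a_inv_degree[OF carrier_is_subring X] by (simp add: var_def)
  ultimately show d: "degree (frobenius_poly q) = q"
    using poly_add_degree_eq[OF carrier_is_subring, of "X [^]\<^bsub>poly_ring R\<^esub> q" "\<ominus>\<^bsub>poly_ring R\<^esub> X"]
      X assms unfolding frobenius_poly_def UP.minus_eq univ_poly_add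
    by (simp add: univ_poly_carrier)
  have "eval (frobenius_poly q) x = x [^] q \<ominus> x" if x: "x \<in> carrier R"
  proof -
    interpret E: ring_hom_ring "poly_ring R" R "\<lambda>f. eval f x"
      using eval_ring_hom[OF carrier_is_subring x] .
    show ?thesis
      unfolding frobenius_poly_def UP.minus_eq using X x
      by (simp add: eval_var E.hom_nat_pow minus_eq)
  qed
  then have "eval (frobenius_poly q) x = \<zero> \<longleftrightarrow> x [^] q = x" if "x \<in> carrier R"
    using that by simp
  then show "is_root (frobenius_poly q) x \<longleftrightarrow> x \<in> carrier R \<and> x [^] q = x"
    unfolding is_root_def using d assms by auto
qed

text \<open>Put \<open>Y = X - a\<close>. Since \<open>a^q = a\<close>, the polynomial is
  \<open>Y^q - Y = Y (Y^(q-1) - 1)\<close>, and the second factor takes the value \<open>-1\<close>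
  at \<open>a\<close>, so \<open>Y\<close> divides it only once.\<close>

lemma (in field) alg_mult_frobenius_poly:
  fixes p q :: nat
  assumes p: "Factorial_Ring.prime p" and char: "[p] \<cdot> \<one> = \<zero>" and q: "q = p ^ k" "1 < q"
    and a: "a \<in> carrier R" "a [^] q = a"
  shows "alg_mult (frobenius_poly q) a \<le> 1"
proof (rule ccontr)
  interpret UP: domain "poly_ring R"
    using univ_poly_is_domain[OF carrier_is_subring] .
  interpret C: ring_hom_ring R "poly_ring R" poly_of_const
    using canonical_embedding_ring_hom[OF carrier_is_subring] by simp
  interpret E: ring_hom_ring "poly_ring R" R "\<lambda>f. eval f a"
    using eval_ring_hom[OF carrier_is_subring a(1)] .
  let ?PR = "poly_ring R" and ?A = "poly_of_const a"
  define Y where "Y = [\<one>, \<ominus> a]"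
  note X = var_closed(1)[OF carrier_is_subring]
  have A: "?A \<in> carrier ?PR" and Y: "Y \<in> carrier ?PR"
    using a C.hom_closed by (auto simp: Y_def univ_poly_carrier[symmetric] polynomial_def)
  have evalY: "eval Y a = \<zero>"
    using a by (simp add: Y_def r_neg)
  have XY: "X = Y \<oplus>\<^bsub>?PR\<^esub> ?A"
    using a by (simp add: univ_poly_add Y_def var_def poly_of_const_def l_neg)
  have "add_pow ?PR p \<one>\<^bsub>?PR\<^esub> = \<zero>\<^bsub>?PR\<^esub>"
    using C.hom_add_pow[OF one_closed, of p] char by simp
  then have "X [^]\<^bsub>?PR\<^esub> q = Y [^]\<^bsub>?PR\<^esub> q \<oplus>\<^bsub>?PR\<^esub> ?A [^]\<^bsub>?PR\<^esub> q"
    unfolding XY q by (rule UP.freshmans_dream_pow[OF p _ Y A])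
  also have "?A [^]\<^bsub>?PR\<^esub> q = ?A"
    using C.hom_nat_pow[OF a(1), of q] a by simp
  finally have "frobenius_poly q = Y [^]\<^bsub>?PR\<^esub> q \<ominus>\<^bsub>?PR\<^esub> Y"
    unfolding frobenius_poly_def XY using Y A
    by (simp add: UP.minus_eq UP.minus_add UP.a_assoc UP.l_neg UP.a_comm[of ?A])
  also have "\<dots> = Y \<otimes>\<^bsub>?PR\<^esub> (Y [^]\<^bsub>?PR\<^esub> (q - 1) \<ominus>\<^bsub>?PR\<^esub> \<one>\<^bsub>?PR\<^esub>)"
  proof -
    have "Y [^]\<^bsub>?PR\<^esub> q = Y \<otimes>\<^bsub>?PR\<^esub> Y [^]\<^bsub>?PR\<^esub> (q - 1)"
      using Y q(2) UP.nat_pow_Suc2[of Y "q - 1"] by simp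
    then show ?thesis
      using Y by (simp add: UP.minus_eq UP.r_distr UP.r_minus)
  qed
  finally have f: "frobenius_poly q = Y \<otimes>\<^bsub>?PR\<^esub> (Y [^]\<^bsub>?PR\<^esub> (q - 1) \<ominus>\<^bsub>?PR\<^esub> \<one>\<^bsub>?PR\<^esub>)" .
  assume "\<not> alg_mult (frobenius_poly q) a \<le> 1"
  then have "2 \<le> alg_mult (frobenius_poly q) a"
    by simp
  then have "Y [^]\<^bsub>?PR\<^esub> (2::nat) pdivides (frobenius_poly q)"
    unfolding Y_def by (rule le_alg_mult_imp_pdivides[OF a(1) frobenius_poly_properties(1)[OF q(2)]])
  then obtain r where r: "r \<in> carrier ?PR" "frobenius_poly q = Y [^]\<^bsub>?PR\<^esub> (2::nat) \<otimes>\<^bsub>?PR\<^esub> r"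
    by (auto simp: pdivides_def factor_def)
  then have "Y \<otimes>\<^bsub>?PR\<^esub> (Y [^]\<^bsub>?PR\<^esub> (q - 1) \<ominus>\<^bsub>?PR\<^esub> \<one>\<^bsub>?PR\<^esub>) = Y \<otimes>\<^bsub>?PR\<^esub> (Y \<otimes>\<^bsub>?PR\<^esub> r)"
    using f Y by (simp add: numeral_2_eq_2 UP.m_assoc)
  moreover have "Y \<noteq> \<zero>\<^bsub>?PR\<^esub>"
    by (simp add: Y_def univ_poly_zero)
  ultimately have "Y [^]\<^bsub>?PR\<^esub> (q - 1) \<ominus>\<^bsub>?PR\<^esub> \<one>\<^bsub>?PR\<^esub> = Y \<otimes>\<^bsub>?PR\<^esub> r"
    using Y r by (simp add: UP.m_lcancel)
  then have "eval (Y [^]\<^bsub>?PR\<^esub> (q - 1) \<ominus>\<^bsub>?PR\<^esub> \<one>\<^bsub>?PR\<^esub>) a = eval (Y \<otimes>\<^bsub>?PR\<^esub> r) a"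
    by simp
  then have "\<zero> [^] (q - 1) \<oplus> \<ominus> \<one> = \<zero>"
    using Y r evalY q(2) by (simp add: UP.minus_eq E.hom_nat_pow)
  then show False
    using q(2) nat_pow_zero[of "q - 1"] by (simp add: minus_equality)
qed

text \<open>The polynomial splits, so it has \<open>q\<close> roots counted with multiplicity, and
  each of them is simple.\<close>

lemma (in algebraically_closed) card_frobenius_poly_roots:
  fixes p q :: nat
  assumes p: "Factorial_Ring.prime p" and char: "[p] \<cdot> \<one> = \<zero>" and q: "q = p ^ k" "1 < q"
  shows "card {x \<in> carrier L. x [^] q = x} = q" "finite {x \<in> carrier L. x [^] q = x}"
proof -
  note f = frobenius_poly_properties[OF q(2)]
  let ?M = "roots (frobenius_poly q)"
  have set: "set_mset ?M = {x \<in> carrier L. x [^] q = x}"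
    using roots_mem_iff_is_root[OF f(1)] f(3) by auto
  then show "finite {x \<in> carrier L. x [^] q = x}"
    by (metis finite_set_mset)
  have "count ?M x \<le> 1" for x
    using alg_mult_frobenius_poly[OF p char q] alg_mult_eq_count_roots[OF f(1)] set
    by (metis (mono_tags, lifting) count_inI mem_Collect_eq zero_le)
  then have "?M = mset_set (set_mset ?M)"
    by (intro multiset_eqI) (metis count_mset_set(1,3) count_greater_zero_iff finite_set_mset
        le_neq_implies_less less_one not_in_iff)
  then have "size ?M = card (set_mset ?M)"
    by (metis size_mset_set)
  moreover have "size ?M = q"
    using roots_over_carrier[OF f(1)] f(2) by (simp add: splitted_def)
  ultimately show "card {x \<in> carrier L. x [^] q = x} = q"
    by (simp add: set)
qed

lemma (in field) subfield_frobenius_fixed: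
  fixes p q :: nat
  assumes p: "Factorial_Ring.prime p" and char: "[p] \<cdot> \<one> = \<zero>" and q: "q = p ^ k"
  shows "subfield {x \<in> carrier R. x [^] q = x} R"
proof (rule subfieldI')
  have "q \<noteq> 0"
    using q p by (simp add: prime_gt_0_nat)
  then have zero: "\<zero> [^] q = \<zero>"
    by (simp add: nat_pow_zero)
  show "subring {x \<in> carrier R. x [^] q = x} R"
  proof (rule subringI)
    fix x y assume x: "x \<in> {x \<in> carrier R. x [^] q = x}" and y: "y \<in> {x \<in> carrier R. x [^] q = x}"
    then show "x \<otimes> y \<in> {x \<in> carrier R. x [^] q = x}" "x \<oplus> y \<in> {x \<in> carrier R. x [^] q = x}"
      using freshmans_dream_pow[OF p char] by (auto simp: q nat_pow_distrib)
    \<comment> \<open>Additivity applied to \<open>x\<close> and its negative avoids a case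
      distinction on the parity of \<open>q\<close>.\<close>
    have "x [^] q \<oplus> (\<ominus> x) [^] q = \<zero>"
      using freshmans_dream_pow[OF p char, of x "\<ominus> x" k] x zero by (simp add: q r_neg)
    then show "\<ominus> x \<in> {x \<in> carrier R. x [^] q = x}"
      using x minus_equality[of "(\<ominus> x) [^] q" x] by (auto simp: a_comm)
  qed auto
  fix x assume x: "x \<in> {x \<in> carrier R. x [^] q = x} - {\<zero>}"
  then have unit: "x \<in> Units R" and x': "x \<in> carrier R" "x [^] q = x"
    by (auto simp: field_Units)
  have "x \<otimes> (inv x) [^] q = x [^] q \<otimes> (inv x) [^] q"
    by (simp only: x'(2))
  also have "\<dots> = (x \<otimes> inv x) [^] q"
    using unit x'(1) by (intro nat_pow_distrib[symmetric]) auto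
  also have "\<dots> = \<one>"
    using unit by simp
  finally have "x \<otimes> (inv x) [^] q = \<one>" .
  then have "inv x = (inv x) [^] q"
    using unit x' by (intro comm_inv_char) auto
  then show "inv x \<in> {x \<in> carrier R. x [^] q = x}"
    using unit by auto
qed

text \<open>The field is the set of roots of \<open>X^q - X\<close> in an algebraic closure of the
  integers modulo \<open>p\<close>; the type is that of the elements of this closure.\<close>

lemma finite_field_exists:
  assumes "primepow q"
  obtains F :: "((int list \<times> nat) multiset \<Rightarrow> int) ring"
  where "field F" "finite (carrier F)" "card (carrier F) = q"
proof -
  obtain p k where pk: "Factorial_Ring.prime p" "k > 0" "q = p ^ k"
    using assms by (auto simp: primepow_def)
  interpret R: residues_prime p "residue_ring (int p)"
    using pk(1) by unfold_locales simp
  obtain L :: "((int list \<times> nat) multiset \<Rightarrow> int) ring" where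
    alg: "algebraic_closure L (R.indexed_const ` carrier (residue_ring (int p)))"
    and hom: "R.indexed_const \<in> ring_hom (residue_ring (int p)) L"
    using field.exists_closure[OF R.is_field] .
  interpret L: algebraic_closure L "R.indexed_const ` carrier (residue_ring (int p))"
    by (rule alg)
  interpret h: ring_hom_ring "residue_ring (int p)" L R.indexed_const
    by (intro ring_hom_ringI2 R.ring_axioms L.ring_axioms hom)
  have "add_pow (residue_ring (int p)) n \<one>\<^bsub>residue_ring (int p)\<^esub> = int n mod int p" for n :: nat
  proof (induction n)
    case 0
    then show ?case by (simp add: R.res_zero_eq)
  next
    case (Suc n)
    then show ?case
      using pk(1) prime_gt_1_nat by (simp add: R.res_add_eq R.res_one_eq mod_simps add.commute)
  qed
  then have "add_pow L p \<one>\<^bsub>L\<^esub> = \<zero>\<^bsub>L\<^esub>"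
    using h.hom_add_pow[OF R.one_closed, of p] by (simp add: R.res_zero_eq[symmetric])
  moreover have "1 < q"
    unfolding pk(3) by (rule one_less_power[OF prime_gt_1_nat[OF pk(1)] pk(2)])
  ultimately show thesis
    using that[of "L\<lparr>carrier := {x \<in> carrier L. x [^]\<^bsub>L\<^esub> q = x}\<rparr>"]
      L.card_frobenius_poly_roots[OF pk(1) _ pk(3)]
      L.subfield_iff(2)[OF L.subfield_frobenius_fixed[OF pk(1) _ pk(3)]] by simp
qed


section \<open>The projective line over a finite field\<close>

context field
begin

text \<open>This is the affine line; infinity is \<open>None\<close>, the new point of the
  extension.\<close>

definition line :: "'a option set" where
  "line = Some ` carrier R"

definition affine :: "'a \<Rightarrow> 'a \<Rightarrow> 'a option \<Rightarrow> 'a option" where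
  "affine a b u = (case u of None \<Rightarrow> None
    | Some s \<Rightarrow> if s \<in> carrier R then Some (a \<otimes> s \<oplus> b) else Some s)"

definition recip :: "'a option \<Rightarrow> 'a option" where
  "recip u = (case u of None \<Rightarrow> Some \<zero>
    | Some s \<Rightarrow> if s = \<zero> then None else if s \<in> carrier R then Some (inv s) else Some s)"

definition AGL :: "('a option \<Rightarrow> 'a option) set" where
  "AGL = {affine a b | a b. a \<in> carrier R - {\<zero>} \<and> b \<in> carrier R}"

definition scalings :: "('a option \<Rightarrow> 'a option) set" where
  "scalings = (\<lambda>a. affine a \<zero>) ` (carrier R - {\<zero>})"

lemma affine_Some: "s \<in> carrier R \<Longrightarrow> affine a b (Some s) = Some (a \<otimes> s \<oplus> b)"
  by (simp add: affine_def)

lemma affine_comp: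
  assumes "a \<in> carrier R" "b \<in> carrier R" "c \<in> carrier R" "d \<in> carrier R"
  shows "affine a b \<circ> affine c d = affine (a \<otimes> c) (a \<otimes> d \<oplus> b)"
proof
  fix u
  show "(affine a b \<circ> affine c d) u = affine (a \<otimes> c) (a \<otimes> d \<oplus> b) u"
  proof (cases u)
    case (Some s)
    then show ?thesis
      using assms by (cases "s \<in> carrier R") (simp_all add: affine_def r_distr m_assoc a_assoc)
  qed (simp add: affine_def)
qed

lemma affine_id: "affine \<one> \<zero> = id"
  by (auto simp: affine_def fun_eq_iff split: option.splits)

lemma inv_nonzero:
  assumes "a \<in> carrier R" "a \<noteq> \<zero>"
  shows "inv a \<in> carrier R" "inv a \<noteq> \<zero>" "a \<otimes> inv a = \<one>" "inv a \<otimes> a = \<one>" "inv (inv a) = a"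
proof -
  have "a \<in> Units R"
    using assms by (simp add: field_Units)
  then show "inv a \<in> carrier R" "a \<otimes> inv a = \<one>" "inv a \<otimes> a = \<one>" "inv (inv a) = a"
    by simp_all
  then show "inv a \<noteq> \<zero>"
    using assms by auto
qed

lemma affine_permutes:
  assumes a: "a \<in> carrier R" "a \<noteq> \<zero>" and b: "b \<in> carrier R"
  shows "affine a b permutes line"
proof -
  note i = inv_nonzero[OF a]
  let ?g = "affine (inv a) (\<ominus> (inv a \<otimes> b))"
  have "?g \<circ> affine a b = id" "affine a b \<circ> ?g = id"
    using a b i
    by (simp_all add: affine_comp r_neg l_neg r_minus m_assoc[symmetric] affine_id)
  then have "bij (affine a b)"
    by (rule o_bij)
  then show ?thesis
    unfolding permutes_def bij_iff by (auto simp: affine_def line_def split: option.splits)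
qed

lemma affine_inject:
  assumes "a \<in> carrier R" "b \<in> carrier R" "c \<in> carrier R" "d \<in> carrier R"
    and eq: "affine a b = affine c d"
  shows "a = c"
proof -
  have "affine a b (Some \<zero>) = affine c d (Some \<zero>)" "affine a b (Some \<one>) = affine c d (Some \<one>)"
    using eq by simp_all
  then show ?thesis
    using assms(1-4) by (simp add: affine_Some)
qed

lemma AGLI: "a \<in> carrier R \<Longrightarrow> a \<noteq> \<zero> \<Longrightarrow> b \<in> carrier R \<Longrightarrow> affine a b \<in> AGL"
  by (auto simp: AGL_def)

lemma AGL_stabilizer: "{g \<in> AGL. g (Some \<zero>) = Some \<zero>} = scalings"
  by (auto simp: AGL_def scalings_def affine_Some)

lemma card_scalings: "card scalings = card (carrier R - {\<zero>})"
  unfolding scalings_def by (rule card_image) (auto intro!: inj_onI dest: affine_inject)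

lemma recip_recip: "recip (recip u) = u"
  by (auto simp: recip_def inv_nonzero split: option.splits)

lemma recip_permutes: "recip permutes insert None line"
proof -
  have "bij recip"
    by (rule o_bij[of recip]) (auto simp: recip_recip)
  then show ?thesis
    unfolding permutes_def bij_iff by (auto simp: recip_def line_def split: option.splits)
qed

lemma minus_one_nonzero: "\<ominus> \<one> \<noteq> \<zero>"
  by (metis minus_minus minus_zero one_closed one_not_zero)

text \<open>This is \<open>1 / (1 / x + 1) = 1 - 1 / (x + 1)\<close>, the double coset condition for
  the translation by one. Infinity, \<open>0\<close> and \<open>-1\<close> are treated
  apart.\<close>

lemma recip_affine_recip:
  "recip \<circ> affine \<one> \<one> \<circ> recip = affine (\<ominus> \<one>) \<one> \<circ> recip \<circ> affine \<one> \<one>"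
proof
  fix u
  consider "u = None" | "u = Some \<zero>" | "u = Some (\<ominus> \<one>)" | s where "u = Some s" "s \<notin> carrier R"
    | s where "u = Some s" "s \<in> carrier R" "s \<noteq> \<zero>" "s \<noteq> \<ominus> \<one>"
    by (cases u) auto
  then show "(recip \<circ> affine \<one> \<one> \<circ> recip) u = (affine (\<ominus> \<one>) \<one> \<circ> recip \<circ> affine \<one> \<one>) u"
  proof cases
    case 3
    have "inv (\<ominus> \<one>) = \<ominus> \<one>"
      by (rule comm_inv_char) (simp_all add: l_minus)
    then show ?thesis
      using 3 minus_one_nonzero by (simp add: recip_def affine_def l_neg)
  next
    case (5 s)
    note i = inv_nonzero[OF 5(2,3)]
    have s1: "s \<oplus> \<one> \<noteq> \<zero>"
      using 5 by (metis minus_equality minus_minus one_closed a_comm)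
    define v where "v = inv (s \<oplus> \<one>)"
    note j = inv_nonzero[OF a_closed[OF 5(2) one_closed] s1, folded v_def]
    \<comment> \<open>With \<open>v = 1 / (s + 1)\<close>, the two sides are reciprocals of
      \<open>(s + 1) / s\<close> and equal to \<open>1 - v = v s\<close>, and these two factors
      multiply to one.\<close>
    have eq: "inv s \<oplus> \<one> = inv s \<otimes> (s \<oplus> \<one>)"
      using 5 i by (simp add: r_distr a_comm)
    have ne: "inv s \<oplus> \<one> \<noteq> \<zero>"
      unfolding eq using 5 i s1 integral by blast
    have "v \<otimes> s \<oplus> v = \<one>"
      using j 5 r_distr[OF 5(2) one_closed j(1)] by simp
    then have v: "\<ominus> v \<oplus> \<one> = v \<otimes> s"
      using j(1) 5(2) a_comm[of "v \<otimes> s" v] r_neg1[of v "v \<otimes> s"] by simp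
    have "(inv s \<oplus> \<one>) \<otimes> (\<ominus> v \<oplus> \<one>) = (inv s \<otimes> (s \<oplus> \<one>)) \<otimes> (v \<otimes> s)"
      unfolding v eq ..
    also have "\<dots> = inv s \<otimes> ((s \<oplus> \<one>) \<otimes> v) \<otimes> s"
      using i(1) j(1) 5(2) by (simp add: m_assoc)
    also have "\<dots> = \<one>"
      using i j 5 by simp
    finally have "inv (inv s \<oplus> \<one>) = \<ominus> v \<oplus> \<one>"
      using i j 5 by (intro comm_inv_char) auto
    then show ?thesis
      using 5 i j s1 ne by (simp add: recip_def affine_def l_minus v_def[symmetric])
  qed (auto simp: recip_def affine_def l_neg)
qed

end

section \<open>PGL(2,q) as an extension of the affine group\<close>

locale finite_field = field +
  assumes finite_carrier: "finite (carrier R)"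
begin

lemma perm_group_AGL: "perm_group line AGL"
  unfolding perm_group_def
proof (intro conjI ballI)
  show "finite line"
    using finite_carrier by (simp add: line_def)
  show "x permutes line" if "x \<in> AGL" for x
    using that affine_permutes by (auto simp: AGL_def)
  show "id \<in> AGL"
    using AGLI[of \<one> \<zero>] by (simp add: affine_id)
  show "x \<circ> y \<in> AGL" if "x \<in> AGL" "y \<in> AGL" for x y
  proof -
    obtain a b c d where *: "x = affine a b" "y = affine c d" "a \<in> carrier R" "a \<noteq> \<zero>"
      "b \<in> carrier R" "c \<in> carrier R" "c \<noteq> \<zero>" "d \<in> carrier R"
      using \<open>x \<in> AGL\<close> \<open>y \<in> AGL\<close> by (auto simp: AGL_def)
    then show ?thesis
      using integral[of a c] by (auto simp: affine_comp intro!: AGLI)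
  qed
qed

lemma zero_line: "Some \<zero> \<in> line"
  by (simp add: line_def)

lemma transitive_AGL: "transitive_on line AGL"
proof (rule transitive_onI[OF perm_group_AGL, where w = "Some \<zero>"])
  fix u assume "u \<in> line"
  then obtain s where "s \<in> carrier R" "u = Some s"
    by (auto simp: line_def)
  then show "\<exists>g\<in>AGL. g (Some \<zero>) = u"
    by (intro bexI[of _ "affine \<one> s"]) (auto simp: affine_Some intro: AGLI)
qed

lemma card_line: "card line = card (carrier R)"
  unfolding line_def by (simp add: card_image)

lemma card_AGL: "card AGL = card (carrier R) * (card (carrier R) - 1)"
  using card_transitive[OF perm_group_AGL transitive_AGL zero_line] finite_carrier
  by (simp add: AGL_stabilizer card_scalings card_line)

text \<open>It suffices to treat scalings, and \<open>a s = s\<close> with \<open>a\<close>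
  different from one forces \<open>s\<close> to be zero.\<close>

lemma fixes_at_most_AGL: "fixes_at_most 1 line AGL"
proof (rule fixes_at_most_transitive[OF perm_group_AGL transitive_AGL zero_line])
  show "fixes_at_most 1 line {g \<in> AGL. g (Some \<zero>) = Some \<zero>}"
    unfolding AGL_stabilizer fixes_at_most_def
  proof (intro ballI impI)
    fix g assume "g \<in> scalings" "g \<noteq> id"
    then obtain a where a: "a \<in> carrier R" "a \<noteq> \<zero>" "g = affine a \<zero>" "a \<noteq> \<one>"
      using affine_id by (auto simp: scalings_def)
    have "{u \<in> line. g u = u} \<subseteq> {Some \<zero>}"
    proof
      fix u assume "u \<in> {u \<in> line. g u = u}"
      then obtain s where s: "u = Some s" "s \<in> carrier R" "a \<otimes> s = s"
        using a by (auto simp: line_def affine_Some)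
      then have "s = \<zero>"
        using a m_rcancel[of s a \<one>] by auto
      then show "u \<in> {Some \<zero>}"
        using s by simp
    qed
    then show "card {u \<in> line. g u = u} \<le> 1"
      using card_mono[of "{Some \<zero>}"] by fastforce
  qed
qed

text \<open>\<open>PGL.ext\<close> is PGL(2,q) on the projective line. The stabiliser of zero
  consists of the scalings, which conjugation by \<open>recip\<close> inverts.\<close>

sublocale PGL: one_point_extension line AGL "Some \<zero>" None recip "affine \<one> \<one>"
proof
  show "None \<notin> line"
    by (auto simp: line_def)
  show "recip \<circ> recip = id"
    by (auto simp: recip_recip)
  show "recip None = Some \<zero>"
    by (simp add: recip_def)
  show "recip \<circ> g \<circ> recip \<in> AGL" if g: "g \<in> AGL" "g (Some \<zero>) = Some \<zero>" for g
  proof -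
    obtain a where a: "a \<in> carrier R" "a \<noteq> \<zero>" "g = affine a \<zero>"
      using g AGL_stabilizer by (auto simp: scalings_def)
    note i = inv_nonzero[OF a(1,2)]
    have inv_mult: "inv (a \<otimes> inv s) = inv a \<otimes> s" if "s \<in> carrier R" "s \<noteq> \<zero>" for s
    proof (rule comm_inv_char)
      note k = inv_nonzero[OF that]
      have "a \<otimes> inv s \<otimes> (inv a \<otimes> s) = (a \<otimes> inv a) \<otimes> (inv s \<otimes> s)"
        using a(1) i(1) that(1) k(1) by (simp add: m_ac)
      then show "a \<otimes> inv s \<otimes> (inv a \<otimes> s) = \<one>"
        using i k by simp
    qed (use a i that inv_nonzero in auto)
    have "recip \<circ> g \<circ> recip = affine (inv a) \<zero>"
    proof
      fix u
      show "(recip \<circ> g \<circ> recip) u = affine (inv a) \<zero> u"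
        using a i
        by (cases u)
          (auto simp: recip_def affine_def inv_nonzero integral_iff inv_mult)
    qed
    then show ?thesis
      using i AGLI by simp
  qed
  show "affine \<one> \<one> \<in> AGL"
    by (rule AGLI) auto
  show "\<exists>a\<in>AGL. a (Some \<zero>) = Some \<zero> \<and> a (affine \<one> \<one> (Some \<zero>)) = u"
    if u: "u \<in> line" "u \<noteq> Some \<zero>" for u
  proof -
    obtain s where "s \<in> carrier R" "u = Some s" "s \<noteq> \<zero>"
      using u by (auto simp: line_def)
    then show ?thesis
      by (intro bexI[of _ "affine s \<zero>"]) (auto simp: affine_Some intro: AGLI)
  qed
  have "affine (\<ominus> \<one>) \<one> \<in> AGL"
    using minus_one_nonzero by (intro AGLI) auto
  then show "recip \<circ> affine \<one> \<one> \<circ> recip \<in> double_coset AGL recip"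
    unfolding recip_affine_recip double_coset_def using AGLI[of \<one> \<one>] by auto
qed (use perm_group_AGL transitive_AGL zero_line recip_permutes in simp_all)

lemma fixes_at_most_PGL: "fixes_at_most 2 (insert None line) PGL.ext"
  using PGL.fixes_at_most_ext[OF fixes_at_most_AGL] by (simp add: numeral_2_eq_2)

lemma card_projective_line: "card (insert None line) = Suc (card (carrier R))"
  using PGL.z perm_groupD(1)[OF perm_group_AGL] by (simp add: card_line)

lemma AGL_PGL: "g \<in> AGL \<Longrightarrow> g \<in> PGL.ext"
  by (simp add: PGL.ext_def)

lemma scalings_PGL: "g \<in> scalings \<Longrightarrow> g \<in> PGL.ext"
  using AGL_stabilizer AGL_PGL by blast

lemma scalings_fix: "g \<in> scalings \<Longrightarrow> g None = None" "g \<in> scalings \<Longrightarrow> g (Some \<zero>) = Some \<zero>"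
  using AGL_stabilizer PGL.G_fixes_z by blast+

section \<open>Counting in PGL(2,q), and the bounds\<close>

lemma card_comp_image:
  assumes "k \<in> PGL.ext"
  shows "card ((\<circ>) k ` S) = card S"
  using perm_groupD(2)[OF PGL.perm_group_ext assms] permutes_inj inj_comp_left card_image by blast

lemma finite_AGL: "finite AGL" "finite scalings"
  using perm_groupD(5)[OF perm_group_AGL] AGL_stabilizer by (auto intro: finite_subset)

text \<open>There are \<open>q (q - 1)\<close> affine maps fixing infinity, and the
  \<open>q - 1\<close> maps \<open>1 / (a x)\<close> swap infinity with zero.\<close>

lemma card_PGL_fixing_or_swapping:
  "(card (carrier R) + 1) * (card (carrier R) - 1)
    \<le> card {g \<in> PGL.ext. g None = None \<or> g None = Some \<zero> \<and> g (Some \<zero>) = None}"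
    (is "_ \<le> card ?C")
proof -
  let ?S = "(\<circ>) recip ` scalings"
  have S: "recip \<circ> g \<in> PGL.ext" "(recip \<circ> g) None = Some \<zero>" "(recip \<circ> g) (Some \<zero>) = None"
    if "g \<in> scalings" for g
    using scalings_fix[OF that] perm_groupD(4)[OF PGL.perm_group_ext PGL.h_in_ext scalings_PGL[OF that]]
    by (auto simp: recip_def)
  have "(card (carrier R) + 1) * (card (carrier R) - 1) = card AGL + card ?S"
    using finite_carrier by (simp add: card_AGL card_comp_image[OF PGL.h_in_ext] card_scalings)
  also have "\<dots> = card (AGL \<union> ?S)"
  proof (rule card_Un_disjoint[symmetric])
    show "AGL \<inter> ?S = {}"
      using S(2) PGL.G_fixes_z by fastforce
  qed (use finite_AGL in simp_all)
  also have "\<dots> \<le> card ?C"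
  proof (rule card_mono)
    have C1: "g \<in> ?C" if "g \<in> AGL" for g
      using AGL_PGL[OF that] PGL.G_fixes_z[OF that] by simp
    have C2: "g \<in> ?C" if g: "g \<in> ?S" for g
    proof -
      obtain f where "f \<in> scalings" "g = recip \<circ> f"
        using g by blast
      then show ?thesis
        using S[of f] by (simp del: o_apply)
    qed
    show "AGL \<union> ?S \<subseteq> ?C"
      by (rule Un_least; rule subsetI; (erule C1 | erule C2))
  qed (use perm_groupD(5)[OF PGL.perm_group_ext] in simp)
  finally show ?thesis .
qed

text \<open>Sending infinity to infinity or zero gives at least \<open>2 q (q - 1)\<close> elements.
  Those sending infinity to one and zero to infinity or zero add \<open>2 (q - 1)\<close>, which
  reaches the stated bound.\<close>

lemma card_PGL_meeting:
  "2 * (card (carrier R) + 1) * (card (carrier R) - 1)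
    \<le> card {g \<in> PGL.ext. g None \<in> {None, Some \<zero>} \<or> g (Some \<zero>) \<in> {None, Some \<zero>}}"
    (is "_ \<le> card ?C")
proof -
  \<comment> \<open>\<open>?s\<close> is \<open>1 / x + 1\<close> and \<open>?t\<close> is
    \<open>x / (x + 1)\<close>. Both send infinity to one; \<open>?s\<close> sends zero to infinity,
    and \<open>?t\<close> fixes zero.\<close>
  let ?s = "affine \<one> \<one> \<circ> recip"
  let ?t = "recip \<circ> ?s"
  let ?A = "{g \<in> PGL.ext. g None = None \<or> g None = Some \<zero>}"
  let ?S = "(\<circ>) ?s ` scalings" and ?T = "(\<circ>) ?t ` scalings"
  have st: "?s \<in> PGL.ext" "?t \<in> PGL.ext"
    using perm_groupD(4)[OF PGL.perm_group_ext] PGL.h_in_ext AGL_PGL PGL.g0(1) by blast+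
  have S: "?s \<circ> g \<in> PGL.ext" "(?s \<circ> g) None = Some \<one>" "(?s \<circ> g) (Some \<zero>) = None"
    if "g \<in> scalings" for g
    using scalings_fix[OF that] perm_groupD(4)[OF PGL.perm_group_ext st(1) scalings_PGL[OF that]]
    by (auto simp: recip_def affine_def comp_assoc)
  have inv1: "inv \<one> = \<one>"
    by simp
  have T: "?t \<circ> g \<in> PGL.ext" "(?t \<circ> g) None = Some \<one>" "(?t \<circ> g) (Some \<zero>) = Some \<zero>"
    if "g \<in> scalings" for g
    using scalings_fix[OF that] perm_groupD(4)[OF PGL.perm_group_ext st(2) scalings_PGL[OF that]]
    by (auto simp: recip_def affine_def comp_assoc inv1)
  have fin: "finite ?A" "finite ?C" "finite ?S" "finite ?T"
    using perm_groupD(5)[OF PGL.perm_group_ext] finite_AGL by simp_all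
  have "2 * (card (carrier R) + 1) * (card (carrier R) - 1) = 2 * card AGL + card ?S + card ?T"
  proof -
    have "2 * (n + 1) * r = 2 * (n * r) + r + r" for n r :: nat
      by (simp add: algebra_simps)
    moreover have "card scalings = card (carrier R) - 1"
      using finite_carrier by (simp add: card_scalings)
    ultimately show ?thesis
      unfolding card_AGL card_comp_image[OF st(1)] card_comp_image[OF st(2)] by simp
  qed
  also have "\<dots> \<le> card ?A + card ?S + card ?T"
    using PGL.card_ext_restricted by simp
  also have "\<dots> = card (?A \<union> ?S) + card ?T"
  proof -
    have "g \<notin> ?A" if "g \<in> ?S" for g
      using that S(2) by auto
    then have "?A \<inter> ?S = {}"
      by blast
    then show ?thesis
      using card_Un_disjoint[of ?A ?S] fin by (simp only:)
  qed
  also have "\<dots> = card (?A \<union> ?S \<union> ?T)"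
  proof -
    have "g \<notin> ?A \<union> ?S" if g: "g \<in> ?T" for g
    proof -
      obtain f where f: "f \<in> scalings" "g = ?t \<circ> f"
        using g by blast
      have g': "g None = Some \<one>" "g (Some \<zero>) = Some \<zero>"
        unfolding f(2) by (rule T(2,3)[OF f(1)])+
      have k: "k (Some \<zero>) = None" if "k \<in> ?S" for k
        using that S(3) by auto
      have "g \<notin> ?S"
        using k[of g] g'(2) by force
      then show ?thesis
        using g'(1) by simp
    qed
    then have "(?A \<union> ?S) \<inter> ?T = {}"
      by blast
    then show ?thesis
      using card_Un_disjoint[of "?A \<union> ?S" ?T] fin by (simp only: finite_Un)
  qed
  also have "\<dots> \<le> card ?C"
  proof (rule card_mono[OF fin(2)])
    have C1: "g \<in> ?C" if g: "g \<in> ?S" for g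
    proof -
      obtain f where "f \<in> scalings" "g = ?s \<circ> f"
        using g by blast
      then show ?thesis
        using S[of f] by (simp del: o_apply)
    qed
    have C2: "g \<in> ?C" if g: "g \<in> ?T" for g
    proof -
      obtain f where "f \<in> scalings" "g = ?t \<circ> f"
        using g by blast
      then show ?thesis
        using T[of f] by (simp del: o_apply)
    qed
    have C3: "g \<in> ?C" if "g \<in> ?A" for g
      using that by auto
    show "?A \<union> ?S \<union> ?T \<subseteq> ?C"
      by (intro Un_least; rule subsetI; (erule C1 | erule C2 | erule C3))
  qed
  finally show ?thesis .
qed

text \<open>On \<open>q + 1\<close> points with at most 2 fixed points, the losses 3, 2, 3 and 4
  give the four distances. The strict lower bounds on \<open>q\<close> make these positive, so
  natural subtraction is never truncated.\<close>

lemma P_bounds: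
  defines "q \<equiv> card (carrier R)"
  shows "4 < q \<Longrightarrow> (q + 1) * q * (q - 1) \<le> P q (q - 4)"
    and "3 < q \<Longrightarrow> 2 * q * (q - 1) \<le> P q (q - 3)"
    and "4 < q \<Longrightarrow> (q + 1) * (q - 1) \<le> P (q - 1) (q - 4)"
    and "6 < q \<Longrightarrow> 2 * (q + 1) * (q - 1) \<le> P (q - 1) (q - 6)"
proof -
  note G = PGL.perm_group_ext fixes_at_most_PGL
  have card: "card (insert None line) = q + 1"
    by (simp add: card_projective_line q_def)
  show "(q + 1) * q * (q - 1) \<le> P q (q - 4)" if "4 < q"
  proof -
    have "(q + 1) * q * (q - 1) = card PGL.ext"
      unfolding PGL.card_ext card_AGL card_line q_def[symmetric] by (simp only: Suc_eq_plus1 mult.assoc)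
    also have "\<dots> \<le> P q (q - 4)"
      using card_le_P_delete_one[OF G, of None "q - 4"] that unfolding card by simp
    finally show ?thesis .
  qed
  show "2 * q * (q - 1) \<le> P q (q - 3)" if "3 < q"
  proof -
    have "2 * q * (q - 1) = 2 * card AGL"
      unfolding card_AGL q_def by simp
    also note PGL.card_ext_restricted
    also have "card {g \<in> PGL.ext. g None = None \<or> g None = Some \<zero>} \<le> P (card (insert None line) - 1) (q - 3)"
      by (rule card_le_P_delete_one_restricted[OF G]) (use that card in auto)
    finally show ?thesis
      by (simp add: card)
  qed
  show "(q + 1) * (q - 1) \<le> P (q - 1) (q - 4)" if "4 < q"
  proof -
    note card_PGL_fixing_or_swapping
    also have "card {g \<in> PGL.ext. g None = None \<or> g None = Some \<zero> \<and> g (Some \<zero>) = None}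
        \<le> P (card (insert None line) - 2) (q - 4)"
      by (rule card_le_P_delete_two_restricted[OF G]) (use that card zero_line in auto)
    finally show ?thesis
      by (simp add: card flip: q_def)
  qed
  show "2 * (q + 1) * (q - 1) \<le> P (q - 1) (q - 6)" if "6 < q"
  proof -
    note card_PGL_meeting
    also have "card {g \<in> PGL.ext. g None \<in> {None, Some \<zero>} \<or> g (Some \<zero>) \<in> {None, Some \<zero>}}
        \<le> P (card (insert None line) - 2) (q - 6)"
      by (rule card_le_P_delete_two[OF G]) (use that card zero_line in auto)
    finally show ?thesis
      by (simp add: card flip: q_def)
  qed
qed

end

theorem corollary2:
  shows "(\<forall>q::nat. primepow q \<longrightarrow>
            (q > 4 \<longrightarrow> P q (q - 4) \<ge> (q + 1) * q * (q - 1)) \<and>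
            (q > 3 \<longrightarrow> P q (q - 3) \<ge> 2 * q * (q - 1)) \<and>
            (q > 4 \<longrightarrow> P (q - 1) (q - 4) \<ge> (q + 1) * (q - 1)) \<and>
            (q > 6 \<longrightarrow> P (q - 1) (q - 6) \<ge> 2 * (q + 1) * (q - 1))) \<and>
         P 11 5 \<ge> 95040 \<and> P 11 6 \<ge> 15840"
proof (intro conjI allI impI)
  fix q :: nat assume "primepow q"
  then obtain F :: "((int list \<times> nat) multiset \<Rightarrow> int) ring"
    where F: "field F" "finite (carrier F)" and q: "card (carrier F) = q"
    using finite_field_exists by blast
  interpret finite_field F
    using F by (simp add: finite_field_def finite_field_axioms_def)
  show "q > 4 \<Longrightarrow> P q (q - 4) \<ge> (q + 1) * q * (q - 1)"
    "q > 3 \<Longrightarrow> P q (q - 3) \<ge> 2 * q * (q - 1)"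
    "q > 4 \<Longrightarrow> P (q - 1) (q - 4) \<ge> (q + 1) * (q - 1)"
    "q > 6 \<Longrightarrow> P (q - 1) (q - 6) \<ge> 2 * (q + 1) * (q - 1)"
    using P_bounds unfolding q by blast+
qed (rule P_11_5 P_11_6)+

end
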